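(* Let $n\geq 1$, let $\overline n=n$ if $n$ is even and $\overline n=n-1$ if $n$ is odd, and let $r$ be an even integer with $0\le r\le\overline n$. Then the conormal fibre at $0$ of $\overline\Sigma_r^{sk,n}$ is isomorphic to $\overline\Sigma_{\overline n-r}^{sk,n}$.
   Context: $\mathbf k$ is an algebraically closed field. $M_n^{sk}$ is the affine space of skew-symmetric $n\times n$ matrices over $\mathbf k$ ($A=-A^T$; skew-symmetric matrices are understood to have even rank, so in characteristic $2$ this means alternating), and $\overline\Sigma_r^{sk,n}=\{A\in M_n^{sk}\mid \mathrm{rank}(A)\le r\}$ is the rank $r$ skew-symmetric determinantal variety. The conormal variety of a closed subvariety $Z\subset M_n^{sk}$ is the closure in $T^*M_n^{sk}=M_n^{sk}\times (M_n^{sk})^*$ of the set of pairs $(x,f)$ with $x$ a smooth point of $Z$ and $f$ vanishing on $T_xZ$. The conormal fibre of $Z$ at $0$ is the fibre of this conormal variety over the point $0$ (regarded as a closed subvariety, with reduced structure). *)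

theory Defs
  imports "HOL-Analysis.Analysis" "HOL-Library.Function_Algebras"
    "HOL-Computational_Algebra.Polynomial" "HOL-Library.Extended_Nat"
begin

section \<open>Closed subvarieties of a finite-dimensional vector space\<close>

text \<open>
  An affine space is given by the scalar multiplication \<open>s\<close> of a \<open>vector_space\<close> together with a
  finite-dimensional linear subspace \<open>V\<close>, its set of points. Closed subvarieties carry the reduced
  structure, so that they are determined by their sets of points.
\<close>

definition linear_form :: "('a::field \<Rightarrow> 'v::ab_group_add \<Rightarrow> 'v) \<Rightarrow> 'v set \<Rightarrow> ('v \<Rightarrow> 'a) \<Rightarrow> bool" where
  "linear_form s V l \<longleftrightarrow>
     (\<forall>x\<in>V. \<forall>y\<in>V. l (x + y) = l x + l y) \<and> (\<forall>c. \<forall>x\<in>V. l (s c x) = c * l x)"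

text \<open>
  The algebra generated by the linear forms: over an infinite field, the coordinate ring
  \<open>Sym(V\<^sup>*)\<close> of the affine space \<open>V\<close>. Only the values on \<open>V\<close> are relevant.
\<close>

inductive_set polyfun :: "('a::field \<Rightarrow> 'v::ab_group_add \<Rightarrow> 'v) \<Rightarrow> 'v set \<Rightarrow> ('v \<Rightarrow> 'a) set"
  for s :: "'a \<Rightarrow> 'v \<Rightarrow> 'v" and V :: "'v set" where
  const: "(\<lambda>_. c) \<in> polyfun s V"
| linear: "linear_form s V l \<Longrightarrow> l \<in> polyfun s V"
| add: "p \<in> polyfun s V \<Longrightarrow> q \<in> polyfun s V \<Longrightarrow> (\<lambda>x. p x + q x) \<in> polyfun s V"
| mult: "p \<in> polyfun s V \<Longrightarrow> q \<in> polyfun s V \<Longrightarrow> (\<lambda>x. p x * q x) \<in> polyfun s V"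

definition zariski_closed :: "('a::field \<Rightarrow> 'v::ab_group_add \<Rightarrow> 'v) \<Rightarrow> 'v set \<Rightarrow> 'v set \<Rightarrow> bool" where
  "zariski_closed s V Z \<longleftrightarrow> (\<exists>P \<subseteq> polyfun s V. Z = {x\<in>V. \<forall>p\<in>P. p x = 0})"

definition zariski_closure :: "('a::field \<Rightarrow> 'v::ab_group_add \<Rightarrow> 'v) \<Rightarrow> 'v set \<Rightarrow> 'v set \<Rightarrow> 'v set" where
  "zariski_closure s V S = \<Inter>{Z. zariski_closed s V Z \<and> S \<subseteq> Z}"

definition irreducible_closed :: "('a::field \<Rightarrow> 'v::ab_group_add \<Rightarrow> 'v) \<Rightarrow> 'v set \<Rightarrow> 'v set \<Rightarrow> bool" where
  "irreducible_closed s V W \<longleftrightarrow> zariski_closed s V W \<and> W \<noteq> {} \<and>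
     (\<forall>A B. zariski_closed s V A \<and> zariski_closed s V B \<and> W \<subseteq> A \<union> B \<longrightarrow> W \<subseteq> A \<or> W \<subseteq> B)"

definition vanishing_ideal :: "('a::field \<Rightarrow> 'v::ab_group_add \<Rightarrow> 'v) \<Rightarrow> 'v set \<Rightarrow> 'v set \<Rightarrow> ('v \<Rightarrow> 'a) set" where
  "vanishing_ideal s V Z = {p \<in> polyfun s V. \<forall>x\<in>Z. p x = 0}"

text \<open>
  The Krull dimension of the local ring of \<open>Z\<close> at \<open>x\<close>: its chains of primes correspond to chains
  of irreducible closed subsets of \<open>Z\<close> passing through \<open>x\<close>.
\<close>

definition local_dim :: "('a::field \<Rightarrow> 'v::ab_group_add \<Rightarrow> 'v) \<Rightarrow> 'v set \<Rightarrow> 'v set \<Rightarrow> 'v \<Rightarrow> enat" where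
  "local_dim s V Z x = Sup {enat m | m. \<exists>W :: nat \<Rightarrow> 'v set.
     (\<forall>i\<le>m. irreducible_closed s V (W i) \<and> x \<in> W i \<and> W i \<subseteq> Z) \<and> (\<forall>i<m. W i \<subset> W (Suc i))}"

text \<open>
  The derivative of a polynomial function \<open>p\<close> at \<open>x\<close> in direction \<open>v\<close> is the coefficient of \<open>t\<close> in
  \<open>p (x + t v)\<close>. Over an infinite field the polynomial in \<open>t\<close> is determined by its values.
\<close>

definition dir_deriv :: "('a::field \<Rightarrow> 'v::ab_group_add \<Rightarrow> 'v) \<Rightarrow> ('v \<Rightarrow> 'a) \<Rightarrow> 'v \<Rightarrow> 'v \<Rightarrow> 'a" where
  "dir_deriv s p x v = coeff (THE q. \<forall>t. poly q t = p (x + s t v)) 1"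

definition tangent_space :: "('a::field \<Rightarrow> 'v::ab_group_add \<Rightarrow> 'v) \<Rightarrow> 'v set \<Rightarrow> 'v set \<Rightarrow> 'v \<Rightarrow> 'v set" where
  "tangent_space s V Z x = {v\<in>V. \<forall>p\<in>vanishing_ideal s V Z. dir_deriv s p x v = 0}"

definition smooth_point :: "('a::field \<Rightarrow> 'v::ab_group_add \<Rightarrow> 'v) \<Rightarrow> 'v set \<Rightarrow> 'v set \<Rightarrow> 'v \<Rightarrow> bool" where
  "smooth_point s V Z x \<longleftrightarrow>
     x \<in> Z \<and> enat (vector_space.dim s (tangent_space s V Z x)) = local_dim s V Z x"

text \<open>Morphisms are the maps that pull back regular functions to regular functions.\<close>

definition morphism ::
  "('a::field \<Rightarrow> 'v::ab_group_add \<Rightarrow> 'v) \<Rightarrow> 'v set \<Rightarrow> 'v set \<Rightarrow>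
   ('a \<Rightarrow> 'w::ab_group_add \<Rightarrow> 'w) \<Rightarrow> 'w set \<Rightarrow> 'w set \<Rightarrow> ('v \<Rightarrow> 'w) \<Rightarrow> bool" where
  "morphism s V Z s' V' Z' \<phi> \<longleftrightarrow> \<phi> ` Z \<subseteq> Z' \<and>
     (\<forall>q\<in>polyfun s' V'. \<exists>p\<in>polyfun s V. \<forall>x\<in>Z. q (\<phi> x) = p x)"

definition isomorphic_varieties ::
  "('a::field \<Rightarrow> 'v::ab_group_add \<Rightarrow> 'v) \<Rightarrow> 'v set \<Rightarrow> 'v set \<Rightarrow>
   ('a \<Rightarrow> 'w::ab_group_add \<Rightarrow> 'w) \<Rightarrow> 'w set \<Rightarrow> 'w set \<Rightarrow> bool" where
  "isomorphic_varieties s V Z s' V' Z' \<longleftrightarrow>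
     (\<exists>\<phi> \<psi>. morphism s V Z s' V' Z' \<phi> \<and> morphism s' V' Z' s V Z \<psi> \<and>
        (\<forall>x\<in>Z. \<psi> (\<phi> x) = x) \<and> (\<forall>y\<in>Z'. \<phi> (\<psi> y) = y))"


section \<open>Conormal varieties\<close>

text \<open>A functional on \<open>V\<close> is represented by its extension by zero outside \<open>V\<close>.\<close>

definition dual_space :: "('a::field \<Rightarrow> 'v::ab_group_add \<Rightarrow> 'v) \<Rightarrow> 'v set \<Rightarrow> ('v \<Rightarrow> 'a) set" where
  "dual_space s V = {f. linear_form s V f \<and> (\<forall>x. x \<notin> V \<longrightarrow> f x = 0)}"

definition dual_scale :: "'a::field \<Rightarrow> ('v \<Rightarrow> 'a) \<Rightarrow> ('v \<Rightarrow> 'a)" where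
  "dual_scale c f = (\<lambda>x. c * f x)"

definition cotangent_scale ::
  "('a::field \<Rightarrow> 'v::ab_group_add \<Rightarrow> 'v) \<Rightarrow> 'a \<Rightarrow> 'v \<times> ('v \<Rightarrow> 'a) \<Rightarrow> 'v \<times> ('v \<Rightarrow> 'a)" where
  "cotangent_scale s c = map_prod (s c) (dual_scale c)"

definition cotangent_space :: "('a::field \<Rightarrow> 'v::ab_group_add \<Rightarrow> 'v) \<Rightarrow> 'v set \<Rightarrow> ('v \<times> ('v \<Rightarrow> 'a)) set" where
  "cotangent_space s V = V \<times> dual_space s V"

definition conormal_variety ::
  "('a::field \<Rightarrow> 'v::ab_group_add \<Rightarrow> 'v) \<Rightarrow> 'v set \<Rightarrow> 'v set \<Rightarrow> ('v \<times> ('v \<Rightarrow> 'a)) set" where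
  "conormal_variety s V Z = zariski_closure (cotangent_scale s) (cotangent_space s V)
     {(x, f). smooth_point s V Z x \<and> f \<in> dual_space s V \<and> (\<forall>v\<in>tangent_space s V Z x. f v = 0)}"

definition conormal_fibre ::
  "('a::field \<Rightarrow> 'v::ab_group_add \<Rightarrow> 'v) \<Rightarrow> 'v set \<Rightarrow> 'v set \<Rightarrow> 'v \<Rightarrow> ('v \<Rightarrow> 'a) set" where
  "conormal_fibre s V Z x = {f. (x, f) \<in> conormal_variety s V Z}"


section \<open>Skew-symmetric determinantal varieties\<close>

definition mat_scale :: "'a::field \<Rightarrow> 'a^'n^'m \<Rightarrow> 'a^'n^'m" where
  "mat_scale c A = map_matrix ((*) c) A"

text \<open>
  The condition on the diagonal, which follows from the first one unless the characteristic
  is 2, makes the matrices alternating.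
\<close>

definition skew_matrices :: "('a::field^'n^'n) set" where
  "skew_matrices = {A. A = - transpose A \<and> (\<forall>i. A $ i $ i = 0)}"

definition skew_determinantal :: "nat \<Rightarrow> ('a::field^'n^'n) set" where
  "skew_determinantal r = {A \<in> skew_matrices. rank A \<le> r}"

definition even_floor :: "nat \<Rightarrow> nat" where
  "even_floor n = (if even n then n else n - 1)"


section \<open>Well-definedness\<close>

lemma vector_space_mat_scale: "vector_space (mat_scale :: 'a::field \<Rightarrow> 'a^'n^'m \<Rightarrow> 'a^'n^'m)"
  by unfold_locales (auto simp: mat_scale_def vec_eq_iff algebra_simps)

lemma vector_space_dual_scale: "vector_space (dual_scale :: 'a::field \<Rightarrow> ('v \<Rightarrow> 'a) \<Rightarrow> ('v \<Rightarrow> 'a))"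
  by unfold_locales (auto simp: dual_scale_def fun_eq_iff algebra_simps)

lemma vector_space_cotangent_scale:
  assumes "vector_space s"
  shows "vector_space (cotangent_scale s)"
proof -
  interpret V: vector_space s by fact
  interpret D: vector_space "dual_scale :: _ \<Rightarrow> ('b \<Rightarrow> 'a) \<Rightarrow> _"
    by (rule vector_space_dual_scale)
  show ?thesis
    by unfold_locales
      (auto simp: cotangent_scale_def V.scale_right_distrib V.scale_left_distrib
        D.scale_right_distrib D.scale_left_distrib)
qed

lemma subspace_skew_matrices:
  "module.subspace mat_scale (skew_matrices :: ('a::field^'n^'n) set)"
proof -
  interpret vector_space "mat_scale :: 'a \<Rightarrow> 'a^'n^'n \<Rightarrow> _"
    by (rule vector_space_mat_scale)
  have skew: "skew_matrices =
    {A :: 'a^'n^'n. (\<forall>i j. A $ i $ j + A $ j $ i = 0) \<and> (\<forall>i. A $ i $ i = 0)}"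
    unfolding skew_matrices_def vec_eq_iff transpose_def
    by (simp add: eq_neg_iff_add_eq_0)
  show ?thesis
  proof (rule subspaceI)
    show "A + B \<in> skew_matrices" if "A \<in> skew_matrices" "B \<in> skew_matrices" for A B :: "'a^'n^'n"
    proof -
      have "(A + B) $ i $ j + (A + B) $ j $ i = (A $ i $ j + A $ j $ i) + (B $ i $ j + B $ j $ i)" for i j
        by (simp only: vector_add_component ac_simps)
      with that show ?thesis by (simp add: skew)
    qed
    show "mat_scale c A \<in> skew_matrices" if "A \<in> skew_matrices" for c and A :: "'a^'n^'n"
      using that unfolding skew mat_scale_def
      by (simp flip: distrib_left)
  qed (simp add: skew)
qed

lemma subspace_dual_space: "module.subspace dual_scale (dual_space s V)"
proof -
  interpret vector_space "dual_scale :: 'a \<Rightarrow> ('b \<Rightarrow> 'a) \<Rightarrow> _"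
    by (rule vector_space_dual_scale)
  show ?thesis
    unfolding subspace_def dual_space_def linear_form_def dual_scale_def
    by (auto simp: algebra_simps)
qed

lemma infinite_UNIV_alg_closed: "infinite (UNIV :: 'a::alg_closed_field set)"
proof
  assume fin: "finite (UNIV :: 'a set)"
  define p :: "'a poly" where "p = (\<Prod>a\<in>UNIV. [:-a, 1:])"
  have deg: "degree p = CARD('a)"
    unfolding p_def by (subst degree_prod_sum_eq) auto
  have "CARD('a) > 0" using fin by (simp add: card_gt_0_iff)
  then have "degree (p + 1) > 0"
    using deg by (subst degree_add_eq_left) auto
  then obtain x where "poly (p + 1) x = 0"
    using alg_closed_imp_poly_has_root by blast
  moreover have "poly p x = 0"
    unfolding p_def poly_prod using fin by (auto intro!: prod_zero bexI[of _ x])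
  ultimately show False by simp
qed

lemma dir_deriv_unique_poly:
  fixes s :: "'a::alg_closed_field \<Rightarrow> 'v::ab_group_add \<Rightarrow> 'v"
  assumes s: "vector_space s" and V: "module.subspace s V"
    and p: "p \<in> polyfun s V" and xv: "x \<in> V" "v \<in> V"
  shows "\<exists>!q. \<forall>t. poly q t = p (x + s t v)"
proof (rule ex_ex1I)
  interpret vector_space s by fact
  show "\<exists>q. \<forall>t. poly q t = p (x + s t v)"
    using p
  proof induction
    case (const c)
    show ?case by (rule exI[of _ "[:c:]"]) simp
  next
    case (linear l)
    then have "l (x + s t v) = l x + t * l v" for t
      using xv subspace_scale[OF V] by (auto simp: linear_form_def)
    then show ?case by (intro exI[of _ "[:l x, l v:]"]) simp
  next
    case (add p q)
    then show ?case by (metis poly_add)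
  next
    case (mult p q)
    then show ?case by (metis poly_mult)
  qed
next
  fix q q' :: "'a poly"
  assume "\<forall>t. poly q t = p (x + s t v)" "\<forall>t. poly q' t = p (x + s t v)"
  then have "{t. poly (q - q') t = 0} = UNIV" by auto
  then show "q = q'"
    using poly_roots_finite[of "q - q'"] infinite_UNIV_alg_closed by (metis right_minus_eq)
qed

end

theory Submission
  imports Defs
begin

text \<open>
  A functional \<open>f\<close> on the alternating \<open>n \<times> n\<close> matrices is represented by the alternating matrix \<open>B\<close>
  with entries \<open>f (e\<^sub>i \<and> e\<^sub>j)\<close>, where \<open>u \<and> a\<close> stands for \<open>u a\<^sup>T - a u\<^sup>T\<close>. This is a linear
  isomorphism, and it maps the conormal fibre at 0 of the variety \<open>Z\<close> of alternating matrices of rank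
  at most \<open>r\<close> onto the alternating matrices of rank at most \<open>n' - r\<close>, where \<open>n'\<close> is the largest even
  number up to \<open>n\<close> (\<open>conormal_fibre_eq\<close>).

  One inclusion (\<open>conormal_rank_le\<close>) uses only that \<open>f\<close> vanishes on the directions of the lines
  through \<open>x\<close> that lie in \<open>Z\<close>. If \<open>x\<close> has rank \<open>r\<close>, then \<open>x + t (x b \<and> a)\<close> is such a line, which gives
  \<open>x B = 0\<close> and \<open>rank B \<le> n - r\<close>; as alternating matrices have even rank, \<open>rank B \<le> n' - r\<close>. If \<open>x\<close>
  has smaller rank, hence rank at most \<open>r - 2\<close>, then all lines through \<open>x\<close> in the directions
  \<open>e\<^sub>i \<and> e\<^sub>j\<close> are contained in \<open>Z\<close>, and \<open>B = 0\<close>. The rank condition on \<open>B\<close> is closed, so it passes to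
  the closure: \<open>rank B \<le> k\<close> means that \<open>det (B + M) = 0\<close> whenever \<open>rank M < n - k\<close>
  (\<open>rank_le_iff_det\<close>).

  For the other inclusion, let \<open>rank B \<le> n' - r\<close>. There are an invertible \<open>P\<close> and a set \<open>I\<close> of \<open>r\<close>
  indices such that the columns of \<open>P\<close> with indices in \<open>I\<close> are in the kernel of \<open>B\<close>. With a
  nondegenerate alternating form \<open>J\<close> on the coordinates in \<open>I\<close>, the point \<open>x = P J P\<^sup>T\<close> has rank \<open>r\<close>,
  and \<open>(u\<^sup>2 x, f)\<close> is a conormal pair for all \<open>u \<noteq> 0\<close> (\<open>conormal_ray\<close>). A polynomial that vanishes on
  these pairs vanishes on \<open>(0, f)\<close>.

  This needs that \<open>P J P\<^sup>T\<close> is a smooth point with the expected tangent space, which is the main part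
  of the work. The tangent space is spanned by the directions \<open>P (e\<^sub>i \<and> e\<^sub>j) P\<^sup>T\<close> with \<open>i \<in> I\<close>: these are
  tangent because of the lines above, and there are no others because of suitable determinants that
  vanish on \<open>Z\<close> (\<open>tangent_entry_eq_0\<close>, \<open>dim_tangent_space\<close>). The local dimension is computed
  from a parametrization \<open>\<Phi>\<close> of a neighbourhood of the point in \<open>Z\<close> by an affine space of the same
  dimension (\<open>local_dim_parametrized\<close>): the functions that separate the members of a chain of
  irreducible closed sets are algebraically independent, so counting monomials bounds the length of
  the chain, and the closures of the images under \<open>\<Phi>\<close> of a flag of coordinate subspaces form a chain
  of the maximal length.
\<close>

section \<open>Polynomial functions and closed sets\<close>

lemma linear_form_zero:
  assumes "linear_form s V l" "vector_space s" "0 \<in> V"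
  shows "l 0 = 0"
  using assms by (metis add.right_neutral add_cancel_right_right linear_form_def)

lemma linear_form_sum:
  assumes l: "linear_form s V l" and s: "vector_space s" and V: "module.subspace s V"
    and f: "\<And>i. i \<in> A \<Longrightarrow> f i \<in> V"
  shows "l (\<Sum>i\<in>A. f i) = (\<Sum>i\<in>A. l (f i))"
proof -
  interpret vector_space s by fact
  have 0: "l 0 = 0"
    using linear_form_zero[OF l s subspace_0[OF V]] .
  show ?thesis
    using f
  proof (induction A rule: infinite_finite_induct)
    case (insert i A)
    moreover have "sum f A \<in> V"
      using insert.prems by (intro subspace_sum V) auto
    ultimately show ?case
      using l by (simp add: linear_form_def)
  qed (simp_all add: 0)
qed

lemma polyfun_sum:
  assumes "\<And>i. i \<in> A \<Longrightarrow> p i \<in> polyfun s V"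
  shows "(\<lambda>x. \<Sum>i\<in>A. p i x) \<in> polyfun s V"
  using assms by (induction A rule: infinite_finite_induct) (auto intro: polyfun.intros)

lemma polyfun_prod:
  assumes "\<And>i. i \<in> A \<Longrightarrow> p i \<in> polyfun s V"
  shows "(\<lambda>x. \<Prod>i\<in>A. p i x) \<in> polyfun s V"
  using assms by (induction A rule: infinite_finite_induct) (auto intro: polyfun.intros)

lemma polyfun_power:
  "p \<in> polyfun s V \<Longrightarrow> (\<lambda>x. p x ^ k) \<in> polyfun s V"
  by (induction k) (auto intro: polyfun.intros)

lemma polyfun_uminus:
  "p \<in> polyfun s V \<Longrightarrow> (\<lambda>x. - p x) \<in> polyfun s V"
  using polyfun.mult[OF polyfun.const[of "-1"]] by simp

lemma polyfun_diff:
  "p \<in> polyfun s V \<Longrightarrow> q \<in> polyfun s V \<Longrightarrow> (\<lambda>x. p x - q x) \<in> polyfun s V"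
  using polyfun.add[OF _ polyfun_uminus] by fastforce

lemma polyfun_det:
  fixes A :: "'v::ab_group_add \<Rightarrow> 'a::field^'n^'n"
  assumes "\<And>i j. (\<lambda>x. A x $ i $ j) \<in> polyfun s V"
  shows "(\<lambda>x. det (A x)) \<in> polyfun s V"
  unfolding det_def using assms
  by (intro polyfun_sum polyfun.mult polyfun.const polyfun_prod)

text \<open>A map that pulls back linear forms to polynomial functions pulls back all of them.\<close>

lemma polyfun_comp:
  assumes p: "p \<in> polyfun s' V'"
    and h: "\<And>l. linear_form s' V' l \<Longrightarrow> (\<lambda>x. l (h x)) \<in> polyfun s V"
  shows "(\<lambda>x. p (h x)) \<in> polyfun s V"
  using p by induction (auto intro: polyfun.intros h)

lemma polyfun_comp_linear:
  assumes p: "p \<in> polyfun s' V'"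
    and h: "\<And>x. x \<in> V \<Longrightarrow> h x \<in> V'"
      "\<And>x y. x \<in> V \<Longrightarrow> y \<in> V \<Longrightarrow> h (x + y) = h x + h y"
      "\<And>c x. x \<in> V \<Longrightarrow> h (s c x) = s' c (h x)"
  shows "(\<lambda>x. p (h x)) \<in> polyfun s V"
  using p by (rule polyfun_comp) (auto intro!: polyfun.linear simp: linear_form_def h)

lemma zariski_closed_subset: "zariski_closed s V Z \<Longrightarrow> Z \<subseteq> V"
  by (auto simp: zariski_closed_def)

lemma zariski_closed_zeros:
  assumes "P \<subseteq> polyfun s V"
  shows "zariski_closed s V {x\<in>V. \<forall>p\<in>P. p x = 0}"
  using assms by (auto simp: zariski_closed_def)

lemma zariski_closed_zero:
  assumes "p \<in> polyfun s V"
  shows "zariski_closed s V {x\<in>V. p x = 0}"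
  using zariski_closed_zeros[of "{p}" s V] assms by simp

lemma zariski_closed_separate:
  assumes "zariski_closed s V Z" "y \<in> V" "y \<notin> Z"
  obtains p where "p \<in> polyfun s V" "\<And>z. z \<in> Z \<Longrightarrow> p z = 0" "p y \<noteq> 0"
  using assms unfolding zariski_closed_def by blast

lemma zariski_closure_superset: "S \<subseteq> zariski_closure s V S"
  by (auto simp: zariski_closure_def)

lemma zariski_closure_minimal:
  "zariski_closed s V Z \<Longrightarrow> S \<subseteq> Z \<Longrightarrow> zariski_closure s V S \<subseteq> Z"
  by (auto simp: zariski_closure_def)

lemma zariski_closure_mono: "S \<subseteq> T \<Longrightarrow> zariski_closure s V S \<subseteq> zariski_closure s V T"
  by (auto simp: zariski_closure_def)

lemma zariski_closure_eq:
  assumes "S \<subseteq> V"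
  shows "zariski_closure s V S =
    {y\<in>V. \<forall>p\<in>polyfun s V. (\<forall>x\<in>S. p x = 0) \<longrightarrow> p y = 0}" (is "_ = ?R")
proof
  have "?R = {y\<in>V. \<forall>p\<in>{p\<in>polyfun s V. \<forall>x\<in>S. p x = 0}. p y = 0}"
    by auto
  then have "zariski_closed s V ?R"
    using zariski_closed_zeros[of "{p\<in>polyfun s V. \<forall>x\<in>S. p x = 0}" s V] by simp
  then show "zariski_closure s V S \<subseteq> ?R"
    using assms by (intro zariski_closure_minimal) auto
  show "?R \<subseteq> zariski_closure s V S"
  proof
    fix y assume y: "y \<in> ?R"
    have "y \<in> Z" if Z: "zariski_closed s V Z" "S \<subseteq> Z" for Z
    proof (rule ccontr)
      assume "y \<notin> Z"
      then obtain p where "p \<in> polyfun s V" "\<And>z. z \<in> Z \<Longrightarrow> p z = 0" "p y \<noteq> 0"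
        using zariski_closed_separate[OF Z(1)] y by blast
      then show False
        using y Z(2) by blast
    qed
    then show "y \<in> zariski_closure s V S"
      by (auto simp: zariski_closure_def)
  qed
qed

lemma zariski_closed_closure:
  assumes "S \<subseteq> V"
  shows "zariski_closed s V (zariski_closure s V S)"
proof -
  have "zariski_closure s V S = {y\<in>V. \<forall>p\<in>{p\<in>polyfun s V. \<forall>x\<in>S. p x = 0}. p y = 0}"
    using zariski_closure_eq[OF assms] by auto
  then show ?thesis
    using zariski_closed_zeros[of "{p\<in>polyfun s V. \<forall>x\<in>S. p x = 0}" s V] by simp
qed

lemma irreducible_closed_domain:
  assumes W: "irreducible_closed s V W" and pq: "p \<in> polyfun s V" "q \<in> polyfun s V"
    and 0: "\<And>x. x \<in> W \<Longrightarrow> p x * q x = 0"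
  shows "(\<forall>x\<in>W. p x = 0) \<or> (\<forall>x\<in>W. q x = 0)"
proof -
  have "W \<subseteq> V"
    using W zariski_closed_subset by (auto simp: irreducible_closed_def)
  then have "W \<subseteq> {x\<in>V. p x = 0} \<union> {x\<in>V. q x = 0}"
    using 0 by auto
  then show ?thesis
    using W zariski_closed_zero[OF pq(1)] zariski_closed_zero[OF pq(2)]
    unfolding irreducible_closed_def by blast
qed

text \<open>
  A set is irreducible when any two of its points are joined by a polynomial curve in it: a
  product of two functions that do not vanish at the two ends does not vanish on the curve,
  because a nonzero polynomial in one variable has finitely many roots.
\<close>

lemma irreducible_closure:
  fixes s :: "'a::alg_closed_field \<Rightarrow> 'v::ab_group_add \<Rightarrow> 'v"
  assumes S: "S \<subseteq> V" "S \<noteq> {}"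
    and curve: "\<And>a b. a \<in> S \<Longrightarrow> b \<in> S \<Longrightarrow> \<exists>\<gamma>. \<gamma> 0 = a \<and> \<gamma> 1 = b \<and> range \<gamma> \<subseteq> S \<and>
      (\<forall>p\<in>polyfun s V. \<exists>q. \<forall>t. poly q t = p (\<gamma> t))"
  shows "irreducible_closed s V (zariski_closure s V S)"
  unfolding irreducible_closed_def
proof (intro conjI allI impI)
  show "zariski_closed s V (zariski_closure s V S)"
    using zariski_closed_closure S(1) .
  show "zariski_closure s V S \<noteq> {}"
    using S(2) zariski_closure_superset by blast
  fix A B
  assume AB: "zariski_closed s V A \<and> zariski_closed s V B \<and> zariski_closure s V S \<subseteq> A \<union> B"
  show "zariski_closure s V S \<subseteq> A \<or> zariski_closure s V S \<subseteq> B"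
  proof (rule ccontr)
    assume "\<not> ?thesis"
    then have "\<not> S \<subseteq> A" "\<not> S \<subseteq> B"
      using AB zariski_closure_minimal by blast+
    then obtain a b where ab: "a \<in> S" "a \<notin> A" "b \<in> S" "b \<notin> B"
      by auto
    obtain p where p: "p \<in> polyfun s V" "\<And>z. z \<in> A \<Longrightarrow> p z = 0" "p a \<noteq> 0"
      using zariski_closed_separate[of s V A a] AB ab S(1) by blast
    obtain q where q: "q \<in> polyfun s V" "\<And>z. z \<in> B \<Longrightarrow> q z = 0" "q b \<noteq> 0"
      using zariski_closed_separate[of s V B b] AB ab S(1) by blast
    obtain \<gamma> where \<gamma>: "\<gamma> 0 = a" "\<gamma> 1 = b" "range \<gamma> \<subseteq> S"
        "\<forall>p\<in>polyfun s V. \<exists>q. \<forall>t. poly q t = p (\<gamma> t)"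
      using curve[OF ab(1,3)] by blast
    obtain p' q' where p': "\<And>t. poly p' t = p (\<gamma> t)" and q': "\<And>t. poly q' t = q (\<gamma> t)"
      using \<gamma>(4) p(1) q(1) by meson
    have "poly p' 0 \<noteq> 0" "poly q' 1 \<noteq> 0"
      using p' q' \<gamma> p q by auto
    then have "p' * q' \<noteq> 0"
      by auto
    then have "finite {t. poly (p' * q') t = 0}"
      by (rule poly_roots_finite)
    moreover have "poly (p' * q') t = 0" for t
    proof -
      have "\<gamma> t \<in> A \<union> B"
        using \<gamma>(3) AB zariski_closure_superset[of S s V] by blast
      then show ?thesis
        using p(2) q(2) p' q' by auto
    qed
    then have "{t. poly (p' * q') t = 0} = UNIV"
      by blast
    ultimately show False
      using infinite_UNIV_alg_closed[where 'a = 'a] by metis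
  qed
qed

section \<open>The dimension of a parametrized variety\<close>

text \<open>
  The affine space with coordinates indexed by \<open>E\<close>, as the functions that vanish outside \<open>E\<close>. In this
  way a subset of \<open>E\<close> gives a coordinate subspace.
\<close>

definition coord_space :: "'e set \<Rightarrow> ('e \<Rightarrow> 'a::field) set" where
  "coord_space E = {t. \<forall>e. e \<notin> E \<longrightarrow> t e = 0}"

lemma subspace_coord_space: "module.subspace dual_scale (coord_space E)"
proof -
  interpret vector_space "dual_scale :: 'a \<Rightarrow> ('b \<Rightarrow> 'a) \<Rightarrow> _"
    by (rule vector_space_dual_scale)
  show ?thesis
    unfolding subspace_def coord_space_def dual_scale_def by auto
qed

lemma polyfun_coordinate: "(\<lambda>t. t e) \<in> polyfun dual_scale (coord_space E)"
  by (rule polyfun.linear) (simp add: linear_form_def dual_scale_def)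

text \<open>The monomials whose degree in each of the variables from \<open>E\<close> is at most \<open>D\<close>, and their span.\<close>

definition box_monomials :: "'e set \<Rightarrow> nat \<Rightarrow> (('e \<Rightarrow> 'a::field) \<Rightarrow> 'a) set" where
  "box_monomials E D = (\<lambda>b t. \<Prod>e\<in>E. t e ^ b e) ` (\<Pi>\<^sub>E e\<in>E. {..D})"

definition box_polys :: "'e set \<Rightarrow> nat \<Rightarrow> (('e \<Rightarrow> 'a::field) \<Rightarrow> 'a) set" where
  "box_polys E D = module.span dual_scale (box_monomials E D)"

lemma finite_box_monomials: "finite E \<Longrightarrow> finite (box_monomials E D)"
  unfolding box_monomials_def by (intro finite_imageI finite_PiE) auto

lemma card_box_monomials:
  assumes "finite E"
  shows "card (box_monomials E D) \<le> (D + 1) ^ card E"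
proof -
  have "card (box_monomials E D) \<le> card (\<Pi>\<^sub>E e\<in>E. {..D})"
    unfolding box_monomials_def using assms by (intro card_image_le finite_PiE) auto
  also have "\<dots> = (D + 1) ^ card E"
    using assms by (simp add: card_PiE)
  finally show ?thesis .
qed

context
begin

interpretation fs: vector_space "dual_scale :: 'a::field \<Rightarrow> ('v \<Rightarrow> 'a) \<Rightarrow> _"
  by (rule vector_space_dual_scale)

lemma box_polys_mono:
  assumes "D \<le> D'"
  shows "box_polys E D \<subseteq> box_polys E D'"
  unfolding box_polys_def box_monomials_def
  using assms by (intro fs.span_mono image_mono PiE_mono) auto

lemma box_monomials_base: "f \<in> box_monomials E D \<Longrightarrow> f \<in> box_polys E D"
  unfolding box_polys_def by (rule fs.span_base)

lemma box_polys_one: "(\<lambda>_. 1) \<in> box_polys E D"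
  by (rule box_monomials_base, unfold box_monomials_def,
      rule image_eqI[of _ _ "\<lambda>e\<in>E. 0"]) auto

lemma box_polys_scale: "f \<in> box_polys E D \<Longrightarrow> (\<lambda>t. c * f t) \<in> box_polys E D"
  unfolding box_polys_def using fs.span_scale[of f _ c] by (simp add: dual_scale_def)

lemma box_polys_const: "(\<lambda>_. c) \<in> box_polys E D"
  using box_polys_scale[OF box_polys_one] by simp

lemma box_polys_coordinate:
  assumes "finite E" "e \<in> E"
  shows "(\<lambda>t. t e) \<in> box_polys E 1"
proof (rule box_monomials_base, unfold box_monomials_def, rule image_eqI)
  show "(\<lambda>x\<in>E. if x = e then 1 else 0 :: nat) \<in> (\<Pi>\<^sub>E e\<in>E. {..1})"
    by auto
  have "(\<Prod>x\<in>E. t x ^ (\<lambda>x\<in>E. if x = e then 1 else 0) x) = (\<Prod>x\<in>E. if x = e then t x else 1)"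
    for t :: "'a \<Rightarrow> 'b"
    by (intro prod.cong) auto
  then show "(\<lambda>t. t e) = (\<lambda>t :: 'a \<Rightarrow> 'b. \<Prod>x\<in>E. t x ^ (\<lambda>x\<in>E. if x = e then 1 else 0) x)"
    using assms by (simp add: prod.delta)
qed

lemma box_polys_add:
  "f \<in> box_polys E D \<Longrightarrow> g \<in> box_polys E D \<Longrightarrow> (\<lambda>t. f t + g t) \<in> box_polys E D"
  unfolding box_polys_def using fs.span_add[of f _ g] by (simp add: plus_fun_def)

lemma box_polys_sum:
  "(\<And>i. i \<in> A \<Longrightarrow> f i \<in> box_polys E D) \<Longrightarrow> (\<lambda>t. \<Sum>i\<in>A. f i t) \<in> box_polys E D"
  by (induction A rule: infinite_finite_induct) (auto intro: box_polys_const box_polys_add)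

lemma box_polys_mult:
  assumes f: "f \<in> box_polys E D" and g: "g \<in> box_polys E D'"
  shows "(\<lambda>t. f t * g t) \<in> box_polys E (D + D')"
proof -
  have mono: "(\<lambda>t. f t * g t) \<in> box_polys E (D + D')"
    if "f \<in> box_monomials E D" "g \<in> box_monomials E D'" for f g
  proof -
    obtain b b' where b: "b \<in> (\<Pi>\<^sub>E e\<in>E. {..D})" "f = (\<lambda>t. \<Prod>e\<in>E. t e ^ b e)"
      and b': "b' \<in> (\<Pi>\<^sub>E e\<in>E. {..D'})" "g = (\<lambda>t. \<Prod>e\<in>E. t e ^ b' e)"
      using \<open>f \<in> _\<close> \<open>g \<in> _\<close> unfolding box_monomials_def by auto
    show ?thesis
    proof (rule box_monomials_base, unfold box_monomials_def, rule image_eqI)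
      show "(\<lambda>e\<in>E. b e + b' e) \<in> (\<Pi>\<^sub>E e\<in>E. {..D + D'})"
        using b b' by (fastforce simp: PiE_iff intro: add_mono)
      show "(\<lambda>t. f t * g t) = (\<lambda>t. \<Prod>e\<in>E. t e ^ (\<lambda>e\<in>E. b e + b' e) e)"
        unfolding b b' by (simp add: power_add flip: prod.distrib cong: prod.cong)
    qed
  qed
  have subsp: "fs.subspace {g. (\<lambda>t. f t * g t) \<in> box_polys E k}" for f k
  proof (rule fs.subspaceI)
    fix g h c
    assume g: "g \<in> {g. (\<lambda>t. f t * g t) \<in> box_polys E k}"
    show "dual_scale c g \<in> {g. (\<lambda>t. f t * g t) \<in> box_polys E k}"
      using box_polys_scale[of "\<lambda>t. f t * g t" E k c] g
      by (simp add: dual_scale_def mult.left_commute)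
    assume h: "h \<in> {g. (\<lambda>t. f t * g t) \<in> box_polys E k}"
    show "g + h \<in> {g. (\<lambda>t. f t * g t) \<in> box_polys E k}"
      using box_polys_add[of "\<lambda>t. f t * g t" E k "\<lambda>t. f t * h t"] g h
      by (simp add: distrib_left)
  qed (simp add: box_polys_const)
  have left: "(\<lambda>t. f t * g t) \<in> box_polys E (D + D')" if "f \<in> box_monomials E D" for f
    using g fs.span_induct[of g "box_monomials E D'"
        "\<lambda>g. (\<lambda>t. f t * g t) \<in> box_polys E (D + D')"] subsp mono[OF that]
    unfolding box_polys_def[of _ D'] by blast
  have "(\<lambda>t. g t * f t) \<in> box_polys E (D + D')"
    using f unfolding box_polys_def[of _ D]
  proof (rule fs.span_induct)
    show "fs.subspace {f. (\<lambda>t. g t * f t) \<in> box_polys E (D + D')}"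
      by (rule subsp)
    show "(\<lambda>t. g t * f t) \<in> box_polys E (D + D')" if "f \<in> box_monomials E D" for f
      using left[OF that] by (simp add: mult.commute)
  qed
  then show ?thesis
    by (simp add: mult.commute)
qed

lemma box_polys_power:
  assumes "f \<in> box_polys E D"
  shows "(\<lambda>t. f t ^ k) \<in> box_polys E (k * D)"
proof (induction k)
  case (Suc k)
  then show ?case
    using box_polys_mult[OF assms Suc] by simp
qed (simp add: box_polys_one)

lemma polyfun_box_polys:
  assumes "finite E" "p \<in> polyfun dual_scale (coord_space E)"
  shows "\<exists>D. \<exists>q\<in>box_polys E D. \<forall>t\<in>coord_space E. p t = q t"
  using assms(2)
proof induction
  case (const c)
  show ?case
    using box_polys_const[of c E 0] by (intro exI[of _ 0] bexI[of _ "\<lambda>_. c"]) auto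
next
  case (linear l)
  define d where "d e = (\<lambda>x. if x = e then 1 else 0 :: 'b)" for e :: 'a
  have "l t = (\<Sum>e\<in>E. l (d e) * t e)" if t: "t \<in> coord_space E" for t
  proof -
    have "(\<Sum>e\<in>E. dual_scale (t e) (d e)) x = t x" for x
    proof -
      have "(\<Sum>e\<in>E. dual_scale (t e) (d e)) x = (\<Sum>e\<in>E. dual_scale (t e) (d e) x)"
        using assms(1) by (induction E rule: finite_induct) auto
      also have "\<dots> = (\<Sum>e\<in>E. if x = e then t e else 0)"
        by (intro sum.cong) (auto simp: dual_scale_def d_def)
      also have "\<dots> = t x"
        using t assms(1) by (auto simp: coord_space_def)
      finally show ?thesis .
    qed
    then have "l t = l (\<Sum>e\<in>E. dual_scale (t e) (d e))"
      by presburger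
    also have "\<dots> = (\<Sum>e\<in>E. l (dual_scale (t e) (d e)))"
      by (rule linear_form_sum[OF linear vector_space_dual_scale subspace_coord_space])
        (auto simp: coord_space_def dual_scale_def d_def)
    also have "\<dots> = (\<Sum>e\<in>E. l (d e) * t e)"
    proof (rule sum.cong)
      fix e assume "e \<in> E"
      then have "d e \<in> coord_space E"
        by (auto simp: coord_space_def d_def)
      then show "l (dual_scale (t e) (d e)) = l (d e) * t e"
        using linear by (simp add: linear_form_def mult.commute)
    qed simp
    finally show ?thesis .
  qed
  moreover have "(\<lambda>t. \<Sum>e\<in>E. l (d e) * t e) \<in> box_polys E 1"
    using assms(1) by (intro box_polys_sum box_polys_scale box_polys_coordinate)
  ultimately show ?case
    by (intro exI[of _ 1] bexI[of _ "\<lambda>t. \<Sum>e\<in>E. l (d e) * t e"]) auto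
next
  case (add p q)
  then obtain D D' p' q' where "p' \<in> box_polys E D" "\<forall>t\<in>coord_space E. p t = p' t"
      "q' \<in> box_polys E D'" "\<forall>t\<in>coord_space E. q t = q' t"
    by auto
  moreover from this have "(\<lambda>t. p' t + q' t) \<in> box_polys E (max D D')"
    using box_polys_mono[of D "max D D'" E] box_polys_mono[of D' "max D D'" E]
    by (intro box_polys_add) auto
  ultimately show ?case
    by (intro exI[of _ "max D D'"] bexI[of _ "\<lambda>t. p' t + q' t"]) auto
next
  case (mult p q)
  then obtain D D' p' q' where "p' \<in> box_polys E D" "\<forall>t\<in>coord_space E. p t = p' t"
      "q' \<in> box_polys E D'" "\<forall>t\<in>coord_space E. q t = q' t"
    by auto
  then show ?case
    by (intro exI[of _ "D + D'"] bexI[of _ "\<lambda>t. p' t * q' t"] box_polys_mult) auto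
qed

text \<open>
  There are at most \<open>(D + 1) ^ card E\<close> such monomials, so a longer family of polynomials in their span
  is linearly dependent.
\<close>

lemma box_polys_relation:
  assumes "finite E" "\<And>i. i < N \<Longrightarrow> f i \<in> box_polys E D" "(D + 1) ^ card E < N"
  shows "\<exists>c. (\<exists>i<N. c i \<noteq> 0) \<and> (\<forall>t. (\<Sum>i<N. c i * f i t) = 0)"
proof (cases "inj_on f {..<N}")
  case True
  have "fs.dependent (f ` {..<N})"
  proof (rule ccontr)
    assume "fs.independent (f ` {..<N})"
    then have "card (f ` {..<N}) \<le> card (box_monomials E D :: ((_ \<Rightarrow> 'b) \<Rightarrow> 'b) set)"
      using fs.independent_span_bound[OF finite_box_monomials[OF assms(1), of D]] assms(2)
      unfolding box_polys_def by auto
    then show False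
      using card_box_monomials[OF assms(1), of D] assms(3) card_image[OF True]
      by (metis card_lessThan le_trans not_le)
  qed
  then obtain c v where c: "(\<Sum>v\<in>f ` {..<N}. dual_scale (c v) v) = 0" "v \<in> f ` {..<N}" "c v \<noteq> 0"
    using fs.dependent_finite[of "f ` {..<N}"] by auto
  have "(\<Sum>i<N. c (f i) * f i t) = 0" for t
  proof -
    have "(\<Sum>i\<in>A. g i) t = (\<Sum>i\<in>A. g i t)" for A :: "nat set" and g :: "nat \<Rightarrow> ('a \<Rightarrow> 'b) \<Rightarrow> 'b"
      by (induction A rule: infinite_finite_induct) auto
    then have "(\<Sum>i<N. c (f i) * f i t) = (\<Sum>i<N. dual_scale (c (f i)) (f i)) t"
      by (simp add: dual_scale_def)
    also have "\<dots> = (\<Sum>v\<in>f ` {..<N}. dual_scale (c v) v) t"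
      using True by (simp add: sum.reindex)
    finally show ?thesis
      using c(1) by simp
  qed
  with c(2,3) show ?thesis
    by (intro exI[of _ "\<lambda>i. c (f i)"]) auto
next
  case False
  then obtain i j where ij: "i < N" "j < N" "i \<noteq> j" "f i = f j"
    by (auto simp: inj_on_def)
  let ?c = "\<lambda>k. if k = i then 1 else if k = j then -1 else 0"
  have "(\<Sum>k<N. ?c k * f k t) = 0" for t
  proof -
    have "(\<Sum>k<N. ?c k * f k t) = (\<Sum>k\<in>{i, j}. ?c k * f k t)"
      using ij by (intro sum.mono_neutral_right) auto
    then show ?thesis
      using ij by simp
  qed
  then show ?thesis
    using ij by (intro exI[of _ ?c]) auto
qed

end

text \<open>
  The monomials in the functions \<open>g 0, \<dots>, g (m - 1)\<close> with exponents below \<open>D\<close>, numbered by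
  reading the exponents as the digits of a number in base \<open>D\<close>.
\<close>

fun digit_monomial :: "(nat \<Rightarrow> 'v \<Rightarrow> 'a::field) \<Rightarrow> nat \<Rightarrow> nat \<Rightarrow> nat \<Rightarrow> 'v \<Rightarrow> 'a" where
  "digit_monomial g D 0 e x = 1"
| "digit_monomial g D (Suc m) e x = digit_monomial g D m (e mod D ^ m) x * g m x ^ (e div D ^ m)"

lemma polyfun_digit_monomial:
  assumes "\<And>i. i < m \<Longrightarrow> g i \<in> polyfun s V"
  shows "digit_monomial g D m e \<in> polyfun s V"
  using assms
proof (induction m arbitrary: e)
  case 0
  have "digit_monomial g D 0 e = (\<lambda>x. 1)"
    by auto
  then show ?case
    using polyfun.const[of 1 s V] by simp
next
  case (Suc m)
  have "digit_monomial g D (Suc m) e =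
      (\<lambda>x. digit_monomial g D m (e mod D ^ m) x * g m x ^ (e div D ^ m))"
    by auto
  then show ?case
    using Suc by (auto intro!: polyfun.mult polyfun_power)
qed

text \<open>
  If \<open>g i\<close> vanishes on \<open>W i\<close> but not on \<open>W (i + 1)\<close>, then \<open>g 0, \<dots>, g (m - 1)\<close> are algebraically
  independent on \<open>W m\<close>: in a relation, the lowest power of \<open>g (m - 1)\<close> can be cancelled as
  \<open>W m\<close> is irreducible, and on \<open>W (m - 1)\<close> only its coefficient remains, which is a relation
  between \<open>g 0, \<dots>, g (m - 2)\<close>.
\<close>

lemma chain_algebraic_independent:
  assumes W: "\<And>i. i \<le> m \<Longrightarrow> irreducible_closed s V (W i)" "\<And>i. i < m \<Longrightarrow> W i \<subseteq> W (Suc i)"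
    and g: "\<And>i. i < m \<Longrightarrow> g i \<in> polyfun s V" "\<And>i x. i < m \<Longrightarrow> x \<in> W i \<Longrightarrow> g i x = 0"
      "\<And>i. i < m \<Longrightarrow> \<exists>x\<in>W (Suc i). g i x \<noteq> 0"
    and c: "\<And>x. x \<in> W m \<Longrightarrow> (\<Sum>e<D ^ m. c e * digit_monomial g D m e x) = 0"
    and D: "D > 0"
  shows "\<forall>e<D ^ m. c e = 0"
  using W g c
proof (induction m arbitrary: c)
  case 0
  then show ?case
    by (auto simp: irreducible_closed_def)
next
  case (Suc m)
  define h where "h j x = (\<Sum>e<D ^ m. c (e + j * D ^ m) * digit_monomial g D m e x)" for j x
  have ph: "h j \<in> polyfun s V" for j
    unfolding h_def by (intro polyfun_sum polyfun.mult polyfun.const polyfun_digit_monomial Suc.prems) auto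
  have sum_h: "(\<Sum>e<D ^ Suc m. c e * digit_monomial g D (Suc m) e x) = (\<Sum>j<D. h j x * g m x ^ j)" for x
  proof -
    have "(\<Sum>e<D ^ Suc m. c e * digit_monomial g D (Suc m) e x) =
      (\<Sum>j<D. \<Sum>e\<in>{j * D ^ m..<j * D ^ m + D ^ m}. c e * digit_monomial g D (Suc m) e x)"
      by (subst sum.nat_group) simp
    also have "\<dots> = (\<Sum>j<D. \<Sum>e<D ^ m. c (e + j * D ^ m) * digit_monomial g D (Suc m) (e + j * D ^ m) x)"
    proof (rule sum.cong)
      fix j
      show "(\<Sum>e\<in>{j * D ^ m..<j * D ^ m + D ^ m}. c e * digit_monomial g D (Suc m) e x) =
        (\<Sum>e<D ^ m. c (e + j * D ^ m) * digit_monomial g D (Suc m) (e + j * D ^ m) x)"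
        using sum.shift_bounds_nat_ivl[of "\<lambda>e. c e * digit_monomial g D (Suc m) e x" 0 "j * D ^ m" "D ^ m"]
        by (simp only: lessThan_atLeast0 add.commute add_0_right add_0_left)
    qed simp
    also have "\<dots> = (\<Sum>j<D. h j x * g m x ^ j)"
      unfolding h_def sum_distrib_right using D
      by (intro sum.cong refl) (simp add: mult.assoc)
    finally show ?thesis .
  qed
  \<comment> \<open>\<open>h j\<close> is the coefficient of \<open>g m ^ j\<close>; the lowest one that is left vanishes on \<open>W m\<close>\<close>
  have "\<forall>e<D ^ m. c (e + j * D ^ m) = 0" if "j < D" for j
    using that
  proof (induction j rule: less_induct)
    case (less j)
    have h0: "h i x = 0" if "i < j" for i x
      using less.IH[OF that] that less.prems unfolding h_def by simp
    define u where "u x = (\<Sum>i\<in>{j..<D}. h i x * g m x ^ (i - j))" for x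
    have pu: "u \<in> polyfun s V"
      unfolding u_def by (intro polyfun_sum polyfun.mult ph polyfun_power Suc.prems) auto
    have gu: "g m x ^ j * u x = 0" if "x \<in> W (Suc m)" for x
    proof -
      have "0 = (\<Sum>i<D. h i x * g m x ^ i)"
        using Suc.prems(6)[OF that] sum_h by simp
      also have "\<dots> = (\<Sum>i\<in>{j..<D}. h i x * g m x ^ i)"
        using h0 by (intro sum.mono_neutral_right) auto
      also have "\<dots> = g m x ^ j * u x"
        unfolding u_def sum_distrib_left
        by (intro sum.cong refl) (simp add: mult.left_commute flip: power_add)
      finally show ?thesis by simp
    qed
    have "(\<forall>x\<in>W (Suc m). g m x ^ j = 0) \<or> (\<forall>x\<in>W (Suc m). u x = 0)"
      using Suc.prems by (intro irreducible_closed_domain[of s V] polyfun_power pu gu) auto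
    moreover have "\<not> (\<forall>x\<in>W (Suc m). g m x ^ j = 0)"
      using Suc.prems(5)[of m] by auto
    ultimately have u0: "u x = 0" if "x \<in> W (Suc m)" for x
      using that by blast
    have "h j x = 0" if x: "x \<in> W m" for x
    proof -
      have "u x = h j x * g m x ^ (j - j) + (\<Sum>i\<in>{Suc j..<D}. h i x * g m x ^ (i - j))"
        unfolding u_def using less.prems by (subst sum.atLeast_Suc_lessThan) auto
      also have "(\<Sum>i\<in>{Suc j..<D}. h i x * g m x ^ (i - j)) = 0"
        using Suc.prems(4)[OF _ x] by (intro sum.neutral) auto
      finally show ?thesis
        using u0 x Suc.prems(2)[of m] by auto
    qed
    then show ?case
      using Suc.prems(1-5) unfolding h_def by (intro Suc.IH) auto
  qed
  then have *: "c (e mod D ^ m + (e div D ^ m) * D ^ m) = 0" if "e div D ^ m < D" for e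
    using that D by simp
  show ?case
  proof (intro allI impI)
    fix e assume "e < D ^ Suc m"
    then have "e div D ^ m < D"
      by (simp add: less_mult_imp_div_less)
    then show "c e = 0"
      using *[of e] by (simp only: mod_div_mult_eq)
  qed
qed

text \<open>
  A chain of irreducible closed sets through \<open>x\<close> is no longer than the number of parameters needed
  to parametrize a neighbourhood \<open>\<delta> \<noteq> 0\<close> of \<open>x\<close>: pulled back to the parameter space, the
  \<open>D ^ m\<close> independent monomials have degree at most \<open>O(D)\<close> in each of the parameters.
\<close>

lemma chain_length_le:
  fixes s :: "'a::field \<Rightarrow> 'v::ab_group_add \<Rightarrow> 'v" and \<Phi> :: "('e \<Rightarrow> 'a) \<Rightarrow> 'v"
  assumes E: "finite E"
    and \<Phi>: "\<And>p. p \<in> polyfun s V \<Longrightarrow> (\<lambda>t. p (\<Phi> t)) \<in> polyfun dual_scale (coord_space E)"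
    and \<delta>: "\<delta> \<in> polyfun s V" "\<delta> x \<noteq> 0" "\<And>z. z \<in> Z \<Longrightarrow> \<delta> z \<noteq> 0 \<Longrightarrow> z \<in> \<Phi> ` coord_space E"
    and W: "\<And>i. i \<le> m \<Longrightarrow> irreducible_closed s V (W i)" "\<And>i. i \<le> m \<Longrightarrow> x \<in> W i"
      "\<And>i. i \<le> m \<Longrightarrow> W i \<subseteq> Z" "\<And>i. i < m \<Longrightarrow> W i \<subset> W (Suc i)"
  shows "m \<le> card E"
proof (rule ccontr)
  assume "\<not> m \<le> card E"
  have "\<exists>p\<in>polyfun s V. (\<forall>x\<in>W i. p x = 0) \<and> (\<exists>x\<in>W (Suc i). p x \<noteq> 0)" if "i < m" for i
  proof -
    have "W i \<subset> W (Suc i)"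
      using W(4) that .
    then obtain y where y: "y \<in> W (Suc i)" "y \<notin> W i"
      by blast
    moreover have "y \<in> V"
      using y W(1)[of "Suc i"] that zariski_closed_subset by (auto simp: irreducible_closed_def)
    moreover have "zariski_closed s V (W i)"
      using W(1)[of i] that by (simp add: irreducible_closed_def)
    ultimately show ?thesis
      using zariski_closed_separate by metis
  qed
  then obtain g where g: "\<And>i. i < m \<Longrightarrow> g i \<in> polyfun s V"
      "\<And>i x. i < m \<Longrightarrow> x \<in> W i \<Longrightarrow> g i x = 0" "\<And>i. i < m \<Longrightarrow> \<exists>x\<in>W (Suc i). g i x \<noteq> 0"
    by metis
  have "\<forall>i. \<exists>D q. i < m \<longrightarrow> q \<in> box_polys E D \<and> (\<forall>t\<in>coord_space E. g i (\<Phi> t) = q t)"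
    using polyfun_box_polys[OF E \<Phi>[OF g(1)]] by blast
  then obtain D\<^sub>0 q where q: "\<And>i. i < m \<Longrightarrow> q i \<in> box_polys E (D\<^sub>0 i)"
      "\<And>i t. i < m \<Longrightarrow> t \<in> coord_space E \<Longrightarrow> g i (\<Phi> t) = q i t"
    by metis
  \<comment> \<open>a common degree bound for all \<open>q i\<close>\<close>
  define C where "C = (\<Sum>i<m. D\<^sub>0 i)"
  have qC: "q i \<in> box_polys E C" if "i < m" for i
    using q(1)[OF that] box_polys_mono[of "D\<^sub>0 i" C E] member_le_sum[of i "{..<m}" D\<^sub>0] that
    unfolding C_def by auto
  \<comment> \<open>large enough for \<open>D ^ m\<close> to exceed \<open>(m * (D * C) + 1) ^ card E\<close>, as \<open>m > card E\<close>\<close>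
  define D where "D = (m * C + 1) ^ card E + 1"
  have mon: "digit_monomial q D k e \<in> box_polys E (k * (D * C))" if "k \<le> m" "e < D ^ k" for k e
    using that
  proof (induction k arbitrary: e)
    case 0
    have "digit_monomial q D 0 e = (\<lambda>_. 1)"
      by auto
    then show ?case
      using box_polys_one by simp
  next
    case (Suc k)
    have "e div D ^ k \<le> D"
      using Suc.prems by (simp add: less_mult_imp_div_less less_imp_le)
    then have "(\<lambda>t. q k t ^ (e div D ^ k)) \<in> box_polys E (D * C)"
      using box_polys_power[OF qC[of k]] box_polys_mono[of "(e div D ^ k) * C" "D * C" E] Suc.prems
      by auto
    moreover have "e mod D ^ k < D ^ k"
      by (simp add: D_def)
    ultimately have "(\<lambda>t. digit_monomial q D k (e mod D ^ k) t * q k t ^ (e div D ^ k))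
        \<in> box_polys E (k * (D * C) + D * C)"
      using Suc by (intro box_polys_mult) auto
    moreover have "digit_monomial q D (Suc k) e =
        (\<lambda>t. digit_monomial q D k (e mod D ^ k) t * q k t ^ (e div D ^ k))"
      by auto
    ultimately show ?case
      by (simp add: add.commute)
  qed
  have "(m * (D * C) + 1) ^ card E \<le> ((m * C + 1) * D) ^ card E"
    by (intro power_mono) (auto simp: D_def algebra_simps)
  also have "\<dots> = (m * C + 1) ^ card E * D ^ card E"
    by (rule power_mult_distrib)
  also have "\<dots> < D * D ^ card E"
    by (intro mult_strict_right_mono) (auto simp: D_def)
  also have "\<dots> \<le> D ^ m"
    using \<open>\<not> m \<le> card E\<close> power_increasing[of "Suc (card E)" m D] by (simp add: D_def)
  finally obtain c where c: "\<exists>e<D ^ m. c e \<noteq> 0"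
      "\<And>t. (\<Sum>e<D ^ m. c e * digit_monomial q D m e t) = 0"
    using box_polys_relation[OF E, of "D ^ m" "digit_monomial q D m" "m * (D * C)"] mon[of m] by blast
  define F where "F z = (\<Sum>e<D ^ m. c e * digit_monomial g D m e z)" for z
  have F: "F \<in> polyfun s V"
    unfolding F_def by (intro polyfun_sum polyfun.mult polyfun.const polyfun_digit_monomial g) auto
  have pull: "digit_monomial g D k e (\<Phi> t) = digit_monomial q D k e t"
    if "t \<in> coord_space E" "k \<le> m" for k e t
    using that by (induction k arbitrary: e) (auto simp: q(2))
  \<comment> \<open>the relation holds where \<open>\<Phi>\<close> is onto, hence on all of \<open>W m\<close> by irreducibility\<close>
  have "\<delta> z * F z = 0" if "z \<in> W m" for z
  proof (cases "\<delta> z = 0")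
    case False
    moreover have "z \<in> Z"
      using W(3)[of m] that by blast
    ultimately obtain t where "t \<in> coord_space E" "z = \<Phi> t"
      using \<delta>(3) by blast
    then show ?thesis
      using c(2)[of t] by (simp add: F_def pull)
  qed simp
  then have "(\<forall>z\<in>W m. \<delta> z = 0) \<or> (\<forall>z\<in>W m. F z = 0)"
    using W(1)[of m] \<delta>(1) F by (intro irreducible_closed_domain[of s V]) auto
  then have "\<forall>z\<in>W m. F z = 0"
    using \<delta>(2) W(2)[of m] by blast
  then have *: "(\<Sum>e<D ^ m. c e * digit_monomial g D m e z) = 0" if "z \<in> W m" for z
    using that by (simp add: F_def)
  have "\<forall>e<D ^ m. c e = 0"
    using W(1) psubset_imp_subset[OF W(4)] g *
    by (rule chain_algebraic_independent) (simp_all add: D_def)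
  then show False
    using c(1) by blast
qed

lemma coord_space_mono: "E \<subseteq> E' \<Longrightarrow> coord_space E \<subseteq> coord_space E'"
  by (auto simp: coord_space_def)

text \<open>
  Conversely, the closures of the images of coordinate subspaces of growing dimension form a chain
  of irreducible closed sets. The inclusions are strict because \<open>c k\<close> vanishes on the image of the
  subspace of the first \<open>k\<close> coordinates, but not on that of the next one.
\<close>

lemma local_dim_ge:
  fixes s :: "'a::alg_closed_field \<Rightarrow> 'v::ab_group_add \<Rightarrow> 'v" and \<Phi> :: "('e \<Rightarrow> 'a) \<Rightarrow> 'v"
  assumes \<Phi>: "\<And>p. p \<in> polyfun s V \<Longrightarrow> (\<lambda>t. p (\<Phi> t)) \<in> polyfun dual_scale (coord_space (set es))"
    and Z: "zariski_closed s V Z" "\<Phi> ` coord_space (set es) \<subseteq> Z"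
    and x: "\<Phi> (\<lambda>_. 0) = x"
    and c: "\<And>k. k < length es \<Longrightarrow> c k \<in> polyfun s V"
      "\<And>k t. k < length es \<Longrightarrow> t \<in> coord_space (set (take k es)) \<Longrightarrow> c k (\<Phi> t) = 0"
      "\<And>k. k < length es \<Longrightarrow> \<exists>t\<in>coord_space (set (take (Suc k) es)). c k (\<Phi> t) \<noteq> 0"
  shows "enat (length es) \<le> local_dim s V Z x"
proof -
  interpret fs: vector_space "dual_scale :: 'a \<Rightarrow> ('e \<Rightarrow> 'a) \<Rightarrow> _"
    by (rule vector_space_dual_scale)
  define L where "L k = (coord_space (set (take k es)) :: ('e \<Rightarrow> 'a) set)" for k
  define W where "W k = zariski_closure s V (\<Phi> ` L k)" for k
  have L_sub: "L k \<subseteq> coord_space (set es)" for k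
    unfolding L_def by (intro coord_space_mono set_take_subset)
  then have sub: "\<Phi> ` L k \<subseteq> Z" for k
    using Z(2) by blast
  have V: "Z \<subseteq> V"
    using Z(1) by (rule zariski_closed_subset)
  have zero: "(\<lambda>_. 0) \<in> L k" for k
    by (simp add: L_def coord_space_def)
  have "irreducible_closed s V (W k)" for k
    unfolding W_def
  proof (rule irreducible_closure)
    show "\<Phi> ` L k \<subseteq> V" "\<Phi> ` L k \<noteq> {}"
      using sub V zero by blast+
    fix a b assume "a \<in> \<Phi> ` L k" "b \<in> \<Phi> ` L k"
    then obtain t u where t: "t \<in> L k" "a = \<Phi> t" and u: "u \<in> L k" "b = \<Phi> u"
      by auto
    let ?\<gamma> = "\<lambda>w. t + dual_scale w (u - t)"
    have ut: "u - t \<in> L k"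
      using subspace_coord_space t u unfolding L_def by (intro fs.subspace_diff)
    then have "?\<gamma> w \<in> L k" for w
      using subspace_coord_space t unfolding L_def by (intro fs.subspace_add fs.subspace_scale)
    moreover have "\<exists>q. \<forall>w. poly q w = p (\<Phi> (?\<gamma> w))" if "p \<in> polyfun s V" for p
      using dir_deriv_unique_poly[OF vector_space_dual_scale subspace_coord_space \<Phi>[OF that],
          of t "u - t"] L_sub t ut by blast
    ultimately show "\<exists>\<gamma>. \<gamma> 0 = a \<and> \<gamma> 1 = b \<and> range \<gamma> \<subseteq> \<Phi> ` L k \<and>
        (\<forall>p\<in>polyfun s V. \<exists>q. \<forall>w. poly q w = p (\<gamma> w))"
      using t u by (intro exI[of _ "\<lambda>w. \<Phi> (?\<gamma> w)"]) auto
  qed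
  moreover have "x \<in> W k" for k
    using zariski_closure_superset[of "\<Phi> ` L k" s V] zero x unfolding W_def by blast
  moreover have "W k \<subseteq> Z" for k
    unfolding W_def using Z(1) sub by (rule zariski_closure_minimal)
  moreover have "W k \<subset> W (Suc k)" if k: "k < length es" for k
  proof -
    have "L k \<subseteq> L (Suc k)"
      unfolding L_def by (intro coord_space_mono set_take_subset_set_take) simp
    then have "W k \<subseteq> W (Suc k)"
      unfolding W_def by (intro zariski_closure_mono image_mono)
    moreover obtain t where t: "t \<in> L (Suc k)" "c k (\<Phi> t) \<noteq> 0"
      using c(3)[OF k] unfolding L_def by blast
    moreover have "\<Phi> t \<in> W (Suc k)"
      using zariski_closure_superset t(1) unfolding W_def by blast
    moreover have "\<Phi> t \<notin> W k"
    proof -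
      have "W k \<subseteq> {z\<in>V. c k z = 0}"
        unfolding W_def using sub V c(2)[OF k] unfolding L_def
        by (intro zariski_closure_minimal zariski_closed_zero c(1) k) auto
      then show ?thesis
        using t(2) by blast
    qed
    ultimately show ?thesis
      by blast
  qed
  ultimately show ?thesis
    unfolding local_dim_def by (intro Sup_upper) blast
qed

lemma local_dim_parametrized:
  fixes s :: "'a::alg_closed_field \<Rightarrow> 'v::ab_group_add \<Rightarrow> 'v" and \<Phi> :: "('e \<Rightarrow> 'a) \<Rightarrow> 'v"
  assumes es: "distinct es"
    and \<Phi>: "\<And>p. p \<in> polyfun s V \<Longrightarrow> (\<lambda>t. p (\<Phi> t)) \<in> polyfun dual_scale (coord_space (set es))"
    and Z: "zariski_closed s V Z" "\<Phi> ` coord_space (set es) \<subseteq> Z"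
    and x: "\<Phi> (\<lambda>_. 0) = x"
    and \<delta>: "\<delta> \<in> polyfun s V" "\<delta> x \<noteq> 0"
      "\<And>z. z \<in> Z \<Longrightarrow> \<delta> z \<noteq> 0 \<Longrightarrow> z \<in> \<Phi> ` coord_space (set es)"
    and c: "\<And>k. k < length es \<Longrightarrow> c k \<in> polyfun s V"
      "\<And>k t. k < length es \<Longrightarrow> t \<in> coord_space (set (take k es)) \<Longrightarrow> c k (\<Phi> t) = 0"
      "\<And>k. k < length es \<Longrightarrow> \<exists>t\<in>coord_space (set (take (Suc k) es)). c k (\<Phi> t) \<noteq> 0"
  shows "local_dim s V Z x = enat (card (set es))"
proof (rule antisym)
  show "local_dim s V Z x \<le> enat (card (set es))"
    unfolding local_dim_def
  proof (intro Sup_least, clarify)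
    fix m and W :: "nat \<Rightarrow> 'v set"
    assume "\<forall>i\<le>m. irreducible_closed s V (W i) \<and> x \<in> W i \<and> W i \<subseteq> Z" "\<forall>i<m. W i \<subset> W (Suc i)"
    then have "m \<le> card (set es)"
      by (intro chain_length_le[OF _ \<Phi> \<delta>, where W = W]) auto
    then show "enat m \<le> enat (card (set es))"
      by simp
  qed
  show "enat (card (set es)) \<le> local_dim s V Z x"
    unfolding distinct_card[OF es] using \<Phi> Z x c by (rule local_dim_ge)
qed

section \<open>Ranks of matrices over a field\<close>

lemma matrix_add_rdistrib:
  fixes A B :: "'a::semiring_1^'n^'m" and C :: "'a^'k^'n"
  shows "(A + B) ** C = A ** C + B ** C"
  by (simp add: matrix_matrix_mult_def vec_eq_iff distrib_right sum.distrib)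

lemma matrix_mult_uminus:
  fixes A :: "'a::comm_ring_1^'n^'m" and B :: "'a^'k^'n"
  shows "(- A) ** B = - (A ** B)" "A ** (- B) = - (A ** B)"
  by (simp_all add: matrix_matrix_mult_def vec_eq_iff sum_negf)

lemma matrix_mult_diff:
  fixes A :: "'a::comm_ring_1^'n^'m" and B :: "'a^'k^'n"
  shows "(A - A') ** B = A ** B - A' ** B" "A ** (B - B') = A ** B - A ** B'"
  by (simp_all add: matrix_matrix_mult_def vec_eq_iff algebra_simps sum_subtractf)

lemma matrix_mult_0:
  fixes A :: "'a::comm_ring_1^'n^'m"
  shows "(0 :: 'a^'m^'k) ** A = 0" "A ** (0 :: 'a^'k^'n) = 0"
  by (simp_all add: matrix_matrix_mult_def vec_eq_iff)

lemma transpose_arith: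
  fixes A B :: "'a::comm_ring_1^'n^'m"
  shows "transpose (A + B) = transpose A + transpose B" "transpose (A - B) = transpose A - transpose B"
    "transpose (- A) = - transpose A"
  by (simp_all add: transpose_def vec_eq_iff)

lemma vector_matrix_mult_component:
  fixes A :: "'a::comm_semiring_1^'n^'m"
  shows "(w v* A) $ j = (\<Sum>i\<in>UNIV. w $ i * A $ i $ j)"
  by (simp add: vector_matrix_mult_def mult.commute)

lemma linear_vector_matrix_mult:
  fixes A :: "'a::field^'n^'m"
  shows "Vector_Spaces.linear (*s) (*s) (\<lambda>w. w v* A)"
proof -
  have "(\<lambda>w. w v* A) = (*v) (transpose A)"
    by auto
  then show ?thesis
    by simp
qed

lemma axis_vector_matrix_mult:
  fixes A :: "'a::comm_semiring_1^'n^'m"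
  shows "axis i 1 v* A = row i A"
proof -
  have "(\<Sum>k\<in>UNIV. axis i 1 $ k * A $ k $ j) = (\<Sum>k\<in>UNIV. if k = i then A $ k $ j else 0)" for j
    by (intro sum.cong) (auto simp: axis_def)
  then show ?thesis
    by (simp add: vec_eq_iff vector_matrix_mult_component row_def)
qed

lemma matrix_vector_axis:
  fixes A :: "'a::comm_semiring_1^'n^'m"
  shows "A *v axis k 1 = column k A"
  using axis_vector_matrix_mult[of k "transpose A"] by simp

lemma rank_eq_dim_range:
  fixes A :: "'a::field^'n^'m"
  shows "rank A = vec.dim (range (\<lambda>w. w v* A))"
proof -
  have "range (\<lambda>w. w v* A) \<subseteq> vec.span (rows A)"
    using matrix_vector_mult_in_columnspace_gen[of "transpose A"] by auto
  moreover have "rows A \<subseteq> range (\<lambda>w. w v* A)"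
    unfolding rows_def by (auto simp flip: axis_vector_matrix_mult)
  ultimately show ?thesis
    unfolding row_rank_def_gen by (metis antisym vec.dim_mono vec.dim_subset)
qed

lemma rank_mult_le_right:
  fixes A :: "'a::field^'n^'m" and B :: "'a^'k^'n"
  shows "rank (A ** B) \<le> rank B"
  unfolding rank_eq_dim_range
  by (intro vec.dim_subset) (auto simp flip: vector_matrix_mul_assoc)

lemma rank_mult_le_left:
  fixes A :: "'a::field^'n^'m" and B :: "'a^'k^'n"
  shows "rank (A ** B) \<le> rank A"
proof -
  have "range (\<lambda>w. w v* (A ** B)) = (\<lambda>y. y v* B) ` range (\<lambda>w. w v* A)"
    by (auto simp flip: vector_matrix_mul_assoc)
  then show ?thesis
    unfolding rank_eq_dim_range by (simp only: vec.dim_image_le linear_vector_matrix_mult)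
qed

lemma rank_add_le:
  fixes A B :: "'a::field^'n^'m"
  shows "rank (A + B) \<le> rank A + rank B"
proof -
  let ?R = "\<lambda>A :: 'a^'n^'m. range (\<lambda>w. w v* A)"
  have sub: "vec.subspace (?R A)" for A
    using module_hom.subspace_image[OF linear_vector_matrix_mult[of A, unfolded linear_iff_module_hom]]
    by simp
  have "?R (A + B) \<subseteq> {x + y |x y. x \<in> ?R A \<and> y \<in> ?R B}"
  proof
    fix y assume "y \<in> ?R (A + B)"
    then obtain w where "y = w v* (A + B)"
      by auto
    then have "y = w v* A + w v* B"
      by (simp add: vec_eq_iff vector_matrix_mult_component distrib_left sum.distrib)
    then show "y \<in> {x + y |x y. x \<in> ?R A \<and> y \<in> ?R B}"
      by blast
  qed
  then have "rank (A + B) \<le> vec.dim {x + y |x y. x \<in> ?R A \<and> y \<in> ?R B}"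
    unfolding rank_eq_dim_range by (rule vec.dim_subset)
  also have "\<dots> \<le> rank A + rank B"
    using vec.dim_sums_Int[OF sub sub, of A B] unfolding rank_eq_dim_range by linarith
  finally show ?thesis .
qed

lemma rank_le_card_rows:
  fixes A :: "'a::field^'n^'m"
  assumes "\<And>i. i \<notin> S \<Longrightarrow> row i A = 0"
  shows "rank A \<le> card S"
proof -
  have "rows A \<subseteq> insert 0 ((\<lambda>i. row i A) ` S)"
    using assms by (auto simp: rows_def)
  also have "\<dots> \<subseteq> vec.span ((\<lambda>i. row i A) ` S)"
    using vec.span_zero vec.span_superset[of "(\<lambda>i. row i A) ` S"] by blast
  finally have "rank A \<le> card ((\<lambda>i. row i A) ` S)"
    unfolding row_rank_def_gen by (rule vec.dim_le_card) simp
  then show ?thesis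
    using card_image_le[of S "\<lambda>i. row i A"] by simp
qed

lemma rank_mat_1: "rank (mat 1 :: 'a::field^'n^'n) = CARD('n)"
  unfolding rank_eq_dim_range by (simp only: vector_matrix_mul_rid image_ident vec_dim_card)

lemma det_add_eq_0:
  fixes A B :: "'a::field^'n^'n"
  assumes "rank A + rank B < CARD('n)"
  shows "det (A + B) = 0"
proof (rule ccontr)
  assume "det (A + B) \<noteq> 0"
  then obtain X where "X ** (A + B) = mat 1"
    using invertible_det_nz invertible_left_inverse by blast
  then have "CARD('n) \<le> rank (A + B)"
    using rank_mult_le_right[of X "A + B"] rank_mat_1[where 'n = 'n and 'a = 'a] by simp
  then show False
    using rank_add_le[of A B] assms by linarith
qed

lemma row_in_rows: "row i A \<in> rows A"
  by (auto simp: rows_def)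

text \<open>
  A row version of the rank factorization: rows of \<open>B\<close> that form a basis of the row space are
  completed to an invertible matrix \<open>G\<close>.
\<close>

lemma rank_factorization:
  fixes B :: "'a::field^'n^'n"
  obtains K :: "'n set" and C G :: "'a^'n^'n"
  where "card K = rank B" "det G \<noteq> 0" "B = C ** G"
    "\<And>i j. j \<notin> K \<Longrightarrow> C $ i $ j = 0" "\<And>i. i \<in> K \<Longrightarrow> row i G = row i B"
proof -
  obtain S where S: "S \<subseteq> rows B" "vec.independent S" "rows B \<subseteq> vec.span S" "card S = rank B"
    using vec.basis_exists[of "rows B"] unfolding row_rank_def_gen by blast
  obtain k where k: "\<And>b. b \<in> S \<Longrightarrow> row (k b) B = b"
    using S(1) unfolding rows_def by (auto simp: subset_iff) metis
  then have inj: "inj_on k S"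
    by (metis inj_onI)
  define K where "K = k ` S"
  have K: "card K = rank B"
    unfolding K_def using card_image[OF inj] S(4) by simp
  define T where "T = vec.extend_basis S"
  have T: "S \<subseteq> T" "vec.independent T" "vec.span T = UNIV"
    unfolding T_def using S(2)
    by (auto simp: vec.extend_basis_superset vec.independent_extend_basis vec.span_extend_basis)
  have "finite T"
    using T(2) by (rule vec.finiteI_independent)
  have "card T = CARD('n)"
    using vec.dim_span_eq_card_independent[OF T(2)] T(3) by (simp only: vec_dim_card)
  have "finite S"
    using T(1) \<open>finite T\<close> by (rule finite_subset)
  then have "card (T - S) = card (- K)"
    using T(1) K S(4) \<open>card T = CARD('n)\<close> by (simp add: card_Diff_subset Compl_eq_Diff_UNIV)
  then obtain h where h: "bij_betw h (- K) (T - S)"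
    using \<open>finite T\<close> finite_same_card_bij[of "- K" "T - S"] by auto
  define G where "G = (\<chi> i. if i \<in> K then row i B else h i)"
  have rowG: "row i G = (if i \<in> K then row i B else h i)" for i
    by (simp add: G_def row_def vec_eq_iff)
  have "T \<subseteq> rows G"
  proof
    fix b assume "b \<in> T"
    then consider "b \<in> S" | "b \<in> T - S"
      by auto
    then show "b \<in> rows G"
    proof cases
      case 1
      then have "row (k b) G = b"
        using k[OF 1] 1 rowG[of "k b"] by (auto simp: K_def)
      then show ?thesis
        using row_in_rows[of "k b" G] by simp
    next
      case 2
      then have "b \<in> h ` (- K)"
        using h by (simp add: bij_betw_def)
      then obtain i where "i \<notin> K" "h i = b"
        by auto
      then have "row i G = b"
        using rowG[of i] by simp
      then show ?thesis
        using row_in_rows[of i G] by simp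
    qed
  qed
  then have "vec.span (rows G) = UNIV"
    using T(3) vec.span_mono by blast
  then have G: "det G \<noteq> 0"
    using matrix_left_invertible_span_rows_gen[of G] invertible_left_inverse invertible_det_nz by blast
  have "\<exists>c. row i B = (\<Sum>b\<in>S. c b *s b)" for i
    using S(3) vec.span_finite[OF vec.finiteI_independent[OF S(2)]] by (force simp: rows_def)
  then obtain c where c: "\<And>i. row i B = (\<Sum>b\<in>S. c i b *s b)"
    by metis
  define C where "C = (\<chi> i j. if j \<in> K then c i (row j B) else 0)"
  have "B $ i $ j = (C ** G) $ i $ j" for i j
  proof -
    have "(C ** G) $ i $ j = (\<Sum>l\<in>UNIV. if l \<in> K then c i (row l B) * row l B $ j else 0)"
      unfolding matrix_matrix_mult_def C_def G_def by (simp add: row_def) (intro sum.cong, auto)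
    also have "\<dots> = (\<Sum>l\<in>K. c i (row l B) * row l B $ j)"
      by (simp add: sum.If_cases)
    also have "\<dots> = (\<Sum>b\<in>S. c i b * b $ j)"
      unfolding K_def using k by (simp add: sum.reindex[OF inj])
    also have "\<dots> = row i B $ j"
      by (subst c) simp
    finally show ?thesis
      by (simp add: row_def)
  qed
  then have "B = C ** G"
    by (simp add: vec_eq_iff)
  show ?thesis
  proof (rule that)
    show "card K = rank B" "det G \<noteq> 0" "B = C ** G"
      by fact+
    show "C $ i $ j = 0" if "j \<notin> K" for i j
      using that by (simp add: C_def)
    show "row i G = row i B" if "i \<in> K" for i
      using that rowG by simp
  qed
qed

text \<open>In the notation above, \<open>M = G - B\<close>, whose rows with indices in \<open>K\<close> vanish.\<close>

lemma complement_rank: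
  fixes B :: "'a::field^'n^'n"
  obtains M where "rank M + rank B \<le> CARD('n)" "det (B + M) \<noteq> 0"
proof -
  obtain K C G where B: "card K = rank B" "det G \<noteq> 0" "\<And>i. i \<in> K \<Longrightarrow> row i G = row i B"
    using rank_factorization[of B] by metis
  have "rank (G - B) \<le> card (- K)"
  proof (rule rank_le_card_rows)
    fix i assume "i \<notin> - K"
    then show "row i (G - B) = 0"
      using B(3)[of i] by (simp add: row_def vec_eq_iff)
  qed
  moreover have "card (- K) + card K = CARD('n)"
    using card_Un_disjoint[of "- K" K] by (simp add: Compl_partition2)
  ultimately show ?thesis
    using that[of "G - B"] B by simp
qed

lemma rank_le_iff_det:
  fixes B :: "'a::field^'n^'n"
  shows "rank B \<le> k \<longleftrightarrow> (\<forall>M. rank M + k < CARD('n) \<longrightarrow> det (B + M) = 0)"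
proof
  assume "rank B \<le> k"
  then show "\<forall>M. rank M + k < CARD('n) \<longrightarrow> det (B + M) = 0"
    by (intro allI impI det_add_eq_0) linarith
next
  assume *: "\<forall>M. rank M + k < CARD('n) \<longrightarrow> det (B + M) = 0"
  obtain M where M: "rank M + rank B \<le> CARD('n)" "det (B + M) \<noteq> 0"
    using complement_rank .
  then have "\<not> rank M + k < CARD('n)"
    using * by blast
  then show "rank B \<le> k"
    using M(1) by linarith
qed

text \<open>With \<open>A + M\<close> invertible and \<open>A B = 0\<close>, the rank of \<open>B\<close> is that of \<open>(A + M) B = M B\<close>.\<close>

lemma rank_add_le_if_mult_0:
  fixes A B :: "'a::field^'n^'n"
  assumes "A ** B = 0"
  shows "rank A + rank B \<le> CARD('n)"
proof -
  obtain M where M: "rank M + rank A \<le> CARD('n)" "det (A + M) \<noteq> 0"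
    using complement_rank .
  then obtain X where "X ** (A + M) = mat 1"
    using invertible_det_nz invertible_left_inverse by blast
  then have "B = X ** (A + M) ** B"
    by simp
  also have "\<dots> = X ** M ** B"
    using assms by (simp add: matrix_add_ldistrib matrix_add_rdistrib flip: matrix_mul_assoc)
  finally have "rank B \<le> rank M"
    using rank_mult_le_left[of "X ** M" B] rank_mult_le_right[of X M] by simp
  then show ?thesis
    using M by linarith
qed

text \<open>
  Rows with indices in \<open>I\<close> that are linearly independent span the row space if the rank is at most
  \<open>|I|\<close>.
\<close>

lemma row_in_span:
  fixes M :: "'a::field^'n^'n"
  assumes rank: "rank M \<le> card I"
    and indep: "\<And>y. (\<And>i. i \<notin> I \<Longrightarrow> y $ i = 0) \<Longrightarrow> y v* M = 0 \<Longrightarrow> y = 0"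
  obtains y where "\<And>i. i \<notin> I \<Longrightarrow> y $ i = 0" "row l M = y v* M"
proof -
  define Y where "Y = {y :: 'a^'n. \<forall>i. i \<notin> I \<longrightarrow> y $ i = 0}"
  have Y: "vec.subspace Y"
    unfolding Y_def by (auto simp: vec.subspace_def)
  interpret lin: module_hom "(*s)" "(*s)" "\<lambda>w. w v* M"
    using linear_vector_matrix_mult[of M] by (simp add: linear_iff_module_hom)
  have "inj_on (\<lambda>y. y v* M) Y"
  proof (rule inj_onI)
    fix y z assume "y \<in> Y" "z \<in> Y" "y v* M = z v* M"
    then have "(y - z) v* M = 0" "\<And>i. i \<notin> I \<Longrightarrow> (y - z) $ i = 0"
      by (simp_all add: lin.diff Y_def)
    then have "y - z = 0"
      using indep by blast
    then show "y = z"
      by simp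
  qed
  moreover have "vec.span Y = Y"
    using Y by (simp only: vec.span_eq_iff)
  ultimately have "inj_on (\<lambda>y. y v* M) (vec.span Y)"
    by (simp only:)
  then have "vec.dim ((\<lambda>y. y v* M) ` Y) = vec.dim Y"
    by (rule vec.dim_image_eq[OF linear_vector_matrix_mult])
  also have "\<dots> = card I"
    unfolding Y_def by (rule dim_substandard_cart)
  finally have "vec.dim (range (\<lambda>y. y v* M)) \<le> vec.dim ((\<lambda>y. y v* M) ` Y)"
    using rank unfolding rank_eq_dim_range by simp
  then have "(\<lambda>y. y v* M) ` Y = range (\<lambda>y. y v* M)"
    using Y by (intro vec.subspace_dim_equal lin.subspace_image) auto
  moreover have "row l M \<in> range (\<lambda>y. y v* M)"
    unfolding axis_vector_matrix_mult[symmetric] by (rule rangeI)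
  ultimately have "row l M \<in> (\<lambda>y. y v* M) ` Y"
    by simp
  then obtain y where "y \<in> Y" "row l M = y v* M" ..
  then show ?thesis
    using that unfolding Y_def by blast
qed

lemma zariski_closed_rank_le:
  fixes h :: "'v::ab_group_add \<Rightarrow> 'a::field^'n^'n"
  assumes "\<And>i j. (\<lambda>x. h x $ i $ j) \<in> polyfun s V"
  shows "zariski_closed s V {x\<in>V. rank (h x) \<le> k}"
proof -
  let ?P = "(\<lambda>M x. det (h x + M)) ` {M. rank M + k < CARD('n)}"
  have "?P \<subseteq> polyfun s V"
    using assms by (auto intro!: polyfun_det polyfun.add polyfun.const)
  then have "zariski_closed s V {x\<in>V. \<forall>p\<in>?P. p x = 0}"
    by (rule zariski_closed_zeros)
  moreover have "{x\<in>V. \<forall>p\<in>?P. p x = 0} = {x\<in>V. rank (h x) \<le> k}"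
    unfolding rank_le_iff_det by auto
  ultimately show ?thesis
    by simp
qed

section \<open>Alternating matrices\<close>

lemma skew_matrices_iff:
  "A \<in> skew_matrices \<longleftrightarrow> (\<forall>i j. A $ i $ j = - A $ j $ i) \<and> (\<forall>i. A $ i $ i = 0)"
  unfolding skew_matrices_def vec_eq_iff transpose_def by simp

lemma skew_diag: "A \<in> skew_matrices \<Longrightarrow> A $ i $ i = 0"
  unfolding skew_matrices_iff by blast

lemma skew_swap: "A \<in> skew_matrices \<Longrightarrow> A $ i $ j = - A $ j $ i"
  unfolding skew_matrices_iff by blast

lemma skew_transpose: "A \<in> skew_matrices \<Longrightarrow> transpose A = - A"
  unfolding skew_matrices_def by (metis (mono_tags, lifting) mem_Collect_eq minus_minus)

lemma skew_zero: "0 \<in> skew_matrices"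
  by (simp add: skew_matrices_iff)

lemma skew_add: "A \<in> skew_matrices \<Longrightarrow> B \<in> skew_matrices \<Longrightarrow> A + B \<in> skew_matrices"
  by (simp add: module.subspace_add[OF vector_space_mat_scale[folded module_iff_vector_space] subspace_skew_matrices])

lemma skew_scale: "A \<in> skew_matrices \<Longrightarrow> mat_scale c A \<in> skew_matrices"
  by (simp add: module.subspace_scale[OF vector_space_mat_scale[folded module_iff_vector_space] subspace_skew_matrices])

lemma mat_scale_component [simp]: "mat_scale c A $ i $ j = c * A $ i $ j"
  by (simp add: mat_scale_def)

text \<open>In any characteristic, the alternating matrices are the differences \<open>U - U\<^sup>T\<close>.\<close>

lemma skew_diff_transpose: "U - transpose U \<in> skew_matrices"
  by (simp add: skew_matrices_iff transpose_def)

lemma skew_obtain_upper: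
  fixes A :: "'a::field^'n^'n"
  assumes "A \<in> skew_matrices"
  obtains U where "A = U - transpose U"
proof -
  obtain ord :: "'n \<Rightarrow> nat" where ord: "inj ord"
    using finite_imp_inj_to_nat_seg[of "UNIV :: 'n set"] by auto
  define U where "U = (\<chi> i j. if ord i < ord j then A $ i $ j else 0)"
  have "A $ i $ j = (U - transpose U) $ i $ j" for i j
    using skew_swap[OF assms, of i j] skew_diag[OF assms, of i] injD[OF ord, of i j]
    by (cases "ord i" "ord j" rule: linorder_cases) (auto simp: U_def transpose_def)
  then show ?thesis
    using that[of U] by (simp add: vec_eq_iff)
qed

text \<open>The action of matrices by congruence, \<open>A \<mapsto> P A P\<^sup>T\<close>.\<close>

definition congruent_matrix :: "'a::field^'n^'n \<Rightarrow> 'a^'n^'n \<Rightarrow> 'a^'n^'n" where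
  "congruent_matrix P A = P ** A ** transpose P"

lemma skew_congruent:
  assumes "A \<in> skew_matrices"
  shows "congruent_matrix P A \<in> skew_matrices"
proof -
  obtain U where U: "A = U - transpose U"
    using skew_obtain_upper[OF assms] .
  have "congruent_matrix P A = P ** U ** transpose P - transpose (P ** U ** transpose P)"
    unfolding U congruent_matrix_def matrix_mult_diff matrix_transpose_mul
    by (simp add: matrix_mul_assoc)
  then show ?thesis
    by (simp add: skew_diff_transpose)
qed

lemma congruent_matrix_compose: "congruent_matrix P (congruent_matrix Q A) = congruent_matrix (P ** Q) A"
  by (simp add: congruent_matrix_def matrix_transpose_mul matrix_mul_assoc)

lemma congruent_matrix_1: "congruent_matrix (mat 1) A = A"
  by (simp add: congruent_matrix_def)

lemma congruent_matrix_add: "congruent_matrix P (A + B) = congruent_matrix P A + congruent_matrix P B"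
  by (simp add: congruent_matrix_def matrix_add_ldistrib matrix_add_rdistrib)

lemma mat_scale_mult:
  fixes A :: "'a::field^'n^'m" and B :: "'a^'k^'n"
  shows "mat_scale c A ** B = mat_scale c (A ** B)" "A ** mat_scale c B = mat_scale c (A ** B)"
  by (simp_all add: vec_eq_iff matrix_matrix_mult_def sum_distrib_left mult.left_commute mult.assoc)

lemma congruent_matrix_scale: "congruent_matrix P (mat_scale c A) = mat_scale c (congruent_matrix P A)"
  by (simp add: congruent_matrix_def mat_scale_mult)

lemma congruent_matrix_0: "congruent_matrix P 0 = 0"
  by (simp add: congruent_matrix_def matrix_mult_0)

lemma rank_congruent_le: "rank (congruent_matrix P A) \<le> rank A"
  unfolding congruent_matrix_def
  using rank_mult_le_left[of "P ** A" "transpose P"] rank_mult_le_right[of P A] by simp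

lemma congruent_matrix_component:
  "congruent_matrix P A $ i $ j = (\<Sum>l\<in>UNIV. (\<Sum>k\<in>UNIV. P $ i $ k * A $ k $ l) * P $ j $ l)"
  by (simp add: congruent_matrix_def matrix_matrix_mult_def transpose_def)

text \<open>The matrix \<open>u a\<^sup>T - a u\<^sup>T\<close>.\<close>

definition wedge :: "'a::field^'n \<Rightarrow> 'a^'n \<Rightarrow> 'a^'n^'n" where
  "wedge u a = (\<chi> i j. u $ i * a $ j - a $ i * u $ j)"

abbreviation unit_wedge :: "'n \<Rightarrow> 'n \<Rightarrow> 'a::field^'n^'n" where
  "unit_wedge i j \<equiv> wedge (axis i 1) (axis j 1)"

lemma wedge_component: "wedge u a $ i $ j = u $ i * a $ j - a $ i * u $ j"
  by (simp add: wedge_def)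

lemma skew_wedge: "wedge u a \<in> skew_matrices"
  by (simp add: skew_matrices_iff wedge_component mult.commute)

lemma rank_wedge_le:
  fixes u a :: "'a::field^'n"
  shows "rank (wedge u a) \<le> 2"
proof -
  have "rows (wedge u a) \<subseteq> vec.span {u, a}"
  proof
    fix b assume "b \<in> rows (wedge u a)"
    then obtain i where "b = row i (wedge u a)"
      by (auto simp: rows_def)
    then have "b = (u $ i) *s a - (a $ i) *s u"
      by (simp add: vec_eq_iff row_def wedge_component)
    then show "b \<in> vec.span {u, a}"
      by (simp add: vec.span_diff vec.span_scale vec.span_base)
  qed
  then have "rank (wedge u a) \<le> card {u, a}"
    unfolding row_rank_def_gen by (rule vec.dim_le_card) simp
  also have "\<dots> \<le> 2"
    by (simp add: card_insert_if)
  finally show ?thesis .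
qed

lemma unit_wedge_component:
  fixes i j k l :: "'n::finite"
  shows "unit_wedge i j $ k $ l =
    (if k = i \<and> l = j then 1 else 0) - (if k = j \<and> l = i then 1 else 0 :: 'a::field)"
proof -
  have "axis i 1 $ k * axis j 1 $ l = (if k = i \<and> l = j then 1 else 0 :: 'a)" for i j k l :: 'n
    unfolding axis_def by (cases "k = i"; cases "l = j") simp_all
  then show ?thesis
    unfolding wedge_def by (simp only: vec_lambda_beta)
qed

lemma wedge_expand:
  fixes u a :: "'a::field^'n"
  shows "wedge u a = (\<Sum>i\<in>UNIV. \<Sum>j\<in>UNIV. mat_scale (u $ i * a $ j) (unit_wedge i j))"
proof -
  have axis: "(\<Sum>j\<in>UNIV. f j * axis j 1 $ l) = f l" for f :: "'n \<Rightarrow> 'a" and l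
  proof -
    have "(\<Sum>j\<in>UNIV. f j * axis j 1 $ l) = (\<Sum>j\<in>UNIV. if j = l then f j else 0)"
      by (intro sum.cong) (auto simp: axis_def)
    then show ?thesis by simp
  qed
  have double: "(\<Sum>i\<in>UNIV. \<Sum>j\<in>UNIV. u $ i * axis i 1 $ k * a $ j * axis j 1 $ l) = u $ k * a $ l" for k l
  proof -
    have "(\<Sum>i\<in>UNIV. \<Sum>j\<in>UNIV. u $ i * axis i 1 $ k * a $ j * axis j 1 $ l) =
        (\<Sum>i\<in>UNIV. (u $ i * a $ l) * axis i 1 $ k)"
      by (intro sum.cong refl) (subst axis, simp)
    then show ?thesis
      by (simp only: axis)
  qed
  have "(\<Sum>i\<in>UNIV. \<Sum>j\<in>UNIV. mat_scale (u $ i * a $ j) (unit_wedge i j)) $ k $ l = wedge u a $ k $ l"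
    for k l
  proof -
    have "(\<Sum>i\<in>UNIV. \<Sum>j\<in>UNIV. mat_scale (u $ i * a $ j) (unit_wedge i j)) $ k $ l =
      (\<Sum>i\<in>UNIV. \<Sum>j\<in>UNIV. u $ i * axis i 1 $ k * a $ j * axis j 1 $ l) -
      (\<Sum>i\<in>UNIV. \<Sum>j\<in>UNIV. u $ i * axis i 1 $ l * a $ j * axis j 1 $ k)"
      unfolding sum_component mat_scale_component wedge_component sum_subtractf[symmetric]
      by (intro sum.cong refl) (simp add: algebra_simps)
    also have "\<dots> = u $ k * a $ l - a $ k * u $ l"
      unfolding double by (simp add: mult.commute)
    finally show ?thesis
      by (simp add: wedge_component)
  qed
  then show ?thesis
    by (simp add: vec_eq_iff)
qed

text \<open>
  Subtracting from \<open>B\<close> a multiple of the wedge product of the rows \<open>i\<close> and \<open>j\<close> clears these two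
  rows when \<open>B $ i $ j \<noteq> 0\<close>, and lowers the rank by exactly 2.
\<close>

lemma even_rank_skew:
  fixes B :: "'a::field^'n^'n"
  assumes "B \<in> skew_matrices"
  shows "even (rank B)"
  using assms
proof (induction "rank B" arbitrary: B rule: less_induct)
  case less
  show ?case
  proof (cases "B = 0")
    case True
    then have "rank B \<le> 0"
      using rank_le_card_rows[of "{}" B] by (simp add: row_def vec_eq_iff)
    then show ?thesis by simp
  next
    case False
    then obtain i j where c: "B $ i $ j \<noteq> 0"
      by (auto simp: vec_eq_iff)
    define u where "u = row i B"
    define a where "a = row j B"
    define W where "W = mat_scale (inverse (B $ i $ j)) (wedge u a)"
    define B' where "B' = B - W"
    note sk = less.prems
    have W: "W \<in> skew_matrices"
      unfolding W_def by (intro skew_scale skew_wedge)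
    have "B' = B + mat_scale (-1) W"
      by (simp add: B'_def vec_eq_iff)
    then have B': "B' \<in> skew_matrices"
      using skew_add[OF sk skew_scale[OF W]] by simp
    have "rank W \<le> 2"
    proof -
      have "W = mat_scale (inverse (B $ i $ j)) (mat 1) ** wedge u a"
        by (simp add: W_def mat_scale_mult)
      then show ?thesis
        using rank_mult_le_right[of "mat_scale (inverse (B $ i $ j)) (mat 1)" "wedge u a"]
          rank_wedge_le[of u a] by simp
    qed
    then have le: "rank B \<le> rank B' + 2"
      using rank_add_le[of B' W] by (simp add: B'_def)
    have col: "B' $ k $ i = 0" "B' $ k $ j = 0" for k
      using c skew_swap[OF sk, of i k] skew_swap[OF sk, of j k] skew_diag[OF sk] skew_swap[OF sk, of j i]
      by (auto simp: B'_def W_def u_def a_def wedge_component row_def field_simps)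
    \<comment> \<open>the rows of \<open>B'\<close> have zero entries in the columns \<open>i, j\<close>, where \<open>u\<close> and \<open>a\<close> form an invertible
      \<open>2 \<times> 2\<close> block, so that \<open>u\<close> and \<open>a\<close> add 2 to the dimension of their span\<close>
    let ?S = "vec.span (rows B')"
    have S0: "x $ i = 0 \<and> x $ j = 0" if "x \<in> ?S" for x
    proof -
      have "vec.subspace {x :: 'a^'n. x $ i = 0 \<and> x $ j = 0}"
        by (auto simp: vec.subspace_def)
      moreover have "rows B' \<subseteq> {x. x $ i = 0 \<and> x $ j = 0}"
        using col by (auto simp: rows_def row_def)
      ultimately show ?thesis
        using vec.span_minimal that by blast
    qed
    have "a \<notin> ?S"
      using S0[of a] c skew_swap[OF sk, of j i] by (auto simp: a_def row_def)
    moreover have "u \<notin> vec.span (insert a (rows B'))"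
    proof
      assume "u \<in> vec.span (insert a (rows B'))"
      then obtain k where "u - k *s a \<in> ?S"
        by (auto simp: vec.span_insert)
      then show False
        using S0[of "u - k *s a"] c skew_diag[OF sk] by (auto simp: u_def a_def row_def)
    qed
    ultimately have "vec.dim (insert u (insert a (rows B'))) = rank B' + 2"
      by (simp add: vec.dim_insert row_rank_def_gen)
    moreover have "insert u (insert a (rows B')) \<subseteq> vec.span (rows B)"
    proof -
      have ua: "u \<in> vec.span (rows B)" "a \<in> vec.span (rows B)"
        unfolding u_def a_def by (intro vec.span_base row_in_rows)+
      have "row k B' \<in> vec.span (rows B)" for k
      proof -
        have "row k B' = row k B - inverse (B $ i $ j) *s (u $ k *s a - a $ k *s u)"
          by (simp add: B'_def W_def vec_eq_iff row_def wedge_component algebra_simps)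
        then show ?thesis
          using ua by (simp add: vec.span_add vec.span_scale vec.span_diff vec.span_base row_in_rows)
      qed
      then show ?thesis
        using ua by (auto simp: rows_def)
    qed
    ultimately have "rank B' + 2 \<le> rank B"
      unfolding row_rank_def_gen using vec.dim_mono by metis
    then have "rank B = rank B' + 2"
      using le by simp
    moreover from this have "even (rank B')"
      using B' by (intro less.hyps) auto
    ultimately show ?thesis
      by simp
  qed
qed

section \<open>Determinantal varieties of alternating matrices\<close>

lemma linear_form_entry: "linear_form mat_scale V (\<lambda>z. z $ i $ j)"
  by (simp add: linear_form_def)

lemma polyfun_entry: "(\<lambda>z. z $ i $ j) \<in> polyfun mat_scale V"
  by (rule polyfun.linear) (rule linear_form_entry)

lemma polyfun_congruent_entry: "(\<lambda>z. congruent_matrix P z $ i $ j) \<in> polyfun mat_scale V"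
  by (rule polyfun.linear) (simp add: linear_form_def congruent_matrix_add congruent_matrix_scale)

text \<open>An alternating matrix in terms of its entries above the diagonal.\<close>

lemma skew_expand:
  fixes A :: "'a::field^'n^'n" and ord :: "'n \<Rightarrow> nat"
  assumes "A \<in> skew_matrices" "inj ord"
  shows "A = (\<Sum>e | ord (fst e) < ord (snd e). mat_scale (A $ fst e $ snd e) (unit_wedge (fst e) (snd e)))"
proof -
  let ?R = "{e. ord (fst e) < ord (snd e)}"
  have "A $ k $ l = (\<Sum>e\<in>?R. mat_scale (A $ fst e $ snd e) (unit_wedge (fst e) (snd e))) $ k $ l" for k l
  proof -
    have mult_indicator_diff: "x * ((if P then 1 else 0) - (if Q then 1 else 0)) =
        (if P then x else 0) - (if Q then x else 0)" for x :: 'a and P Q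
      by (cases P; cases Q) simp_all
    have split: "mat_scale (A $ fst e $ snd e) (unit_wedge (fst e) (snd e)) $ k $ l =
        (if e = (k, l) then A $ k $ l else 0) - (if e = (l, k) then A $ l $ k else 0)" for e
    proof -
      obtain a b where e: "e = (a, b)"
        by fastforce
      show ?thesis
        unfolding e mat_scale_component unit_wedge_component fst_conv snd_conv mult_indicator_diff
        by (intro arg_cong2[where f = "(-)"] if_cong) auto
    qed
    have "(\<Sum>e\<in>?R. mat_scale (A $ fst e $ snd e) (unit_wedge (fst e) (snd e))) $ k $ l =
        (\<Sum>e\<in>?R. if e = (k, l) then A $ k $ l else 0) - (\<Sum>e\<in>?R. if e = (l, k) then A $ l $ k else 0)"
      by (simp only: sum_component split sum_subtractf)
    also have "\<dots> = (if ord k < ord l then A $ k $ l else 0) - (if ord l < ord k then A $ l $ k else 0)"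
      by (subst (1 2) sum.delta) auto
    also have "\<dots> = A $ k $ l"
    proof (cases "k = l")
      case True
      then show ?thesis
        by (simp add: skew_diag[OF assms(1)])
    next
      case False
      then have "ord k < ord l \<or> ord l < ord k"
        using injD[OF assms(2)] by (metis nat_neq_iff)
      then show ?thesis
        using skew_swap[OF assms(1), of l k] by auto
    qed
    finally show ?thesis ..
  qed
  then show ?thesis
    unfolding vec_eq_iff by blast
qed

lemma linear_form_wedge:
  assumes "linear_form mat_scale skew_matrices f"
  shows "f (wedge u a) = (\<Sum>i\<in>UNIV. \<Sum>j\<in>UNIV. u $ i * a $ j * f (unit_wedge i j))"
proof -
  note ls = linear_form_sum[OF assms vector_space_mat_scale subspace_skew_matrices]
  have sk: "(\<Sum>j\<in>UNIV. mat_scale (u $ i * a $ j) (unit_wedge i j)) \<in> skew_matrices" for i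
    by (intro module.subspace_sum[OF vector_space_mat_scale[folded module_iff_vector_space] subspace_skew_matrices]
        skew_scale skew_wedge)
  show ?thesis
    unfolding wedge_expand[of u a]
    using assms by (simp add: ls sk skew_scale skew_wedge linear_form_def)
qed

lemma zariski_closed_skew_determinantal:
  "zariski_closed mat_scale skew_matrices (skew_determinantal r :: ('a::field^'n^'n) set)"
  unfolding skew_determinantal_def using zariski_closed_rank_le[OF polyfun_entry] by auto

section \<open>Tangent spaces\<close>

lemma dir_deriv_eq:
  fixes p :: "'v::ab_group_add \<Rightarrow> 'a::alg_closed_field"
  assumes "\<And>t. poly q t = p (x + s t v)"
  shows "dir_deriv s p x v = coeff q 1"
proof -
  have "(THE q. \<forall>t. poly q t = p (x + s t v)) = q"
  proof (rule the_equality)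
    fix q' assume "\<forall>t. poly q' t = p (x + s t v)"
    then have "{t. poly (q' - q) t = 0} = UNIV"
      using assms by auto
    then show "q' = q"
      using poly_roots_finite[of "q' - q"] infinite_UNIV_alg_closed by (metis right_minus_eq)
  qed (use assms in blast)
  then show ?thesis
    by (simp add: dir_deriv_def)
qed

text \<open>The direction of a line in \<open>Z\<close> is tangent, as the functions of the ideal vanish on the line.\<close>

lemma line_in_tangent_space:
  fixes s :: "'a::alg_closed_field \<Rightarrow> 'v::ab_group_add \<Rightarrow> 'v"
  assumes "v \<in> V" "\<And>t. x + s t v \<in> Z"
  shows "v \<in> tangent_space s V Z x"
proof -
  have "dir_deriv s p x v = 0" if "p \<in> vanishing_ideal s V Z" for p
    using that assms(2) dir_deriv_eq[of 0 p x s v] by (simp add: vanishing_ideal_def)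
  then show ?thesis
    using assms(1) by (simp add: tangent_space_def)
qed

text \<open>The matrix \<open>a b\<^sup>T\<close>.\<close>

definition outer :: "'a::field^'n \<Rightarrow> 'a^'n \<Rightarrow> 'a^'n^'n" where
  "outer a b = (\<chi> i j. a $ i * b $ j)"

lemma skew_quadratic_form:
  fixes A :: "'a::field^'n^'n"
  assumes "A \<in> skew_matrices"
  shows "(\<Sum>i\<in>UNIV. \<Sum>j\<in>UNIV. b $ i * A $ i $ j * b $ j) = 0"
proof -
  obtain U where U: "A = U - transpose U"
    using skew_obtain_upper[OF assms] .
  have "(\<Sum>i\<in>UNIV. \<Sum>j\<in>UNIV. b $ i * A $ i $ j * b $ j) =
      (\<Sum>i\<in>UNIV. \<Sum>j\<in>UNIV. b $ i * U $ i $ j * b $ j) - (\<Sum>i\<in>UNIV. \<Sum>j\<in>UNIV. b $ i * U $ j $ i * b $ j)"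
    unfolding U sum_subtractf[symmetric]
    by (intro sum.cong refl) (simp add: transpose_def algebra_simps)
  also have "(\<Sum>i\<in>UNIV. \<Sum>j\<in>UNIV. b $ i * U $ j $ i * b $ j) =
      (\<Sum>i\<in>UNIV. \<Sum>j\<in>UNIV. b $ i * U $ i $ j * b $ j)"
    by (subst sum.swap) (intro sum.cong refl, simp add: mult.assoc mult.commute mult.left_commute)
  finally show ?thesis
    by simp
qed

text \<open>
  Transforming \<open>A\<close> with \<open>1 + t a b\<^sup>T\<close> gives the points of a line, because the term of order \<open>t\<^sup>2\<close> is
  \<open>a (b\<^sup>T A b) a\<^sup>T = 0\<close>.
\<close>

lemma add_wedge_congruent:
  fixes A :: "'a::field^'n^'n"
  assumes A: "A \<in> skew_matrices"
  shows "A + mat_scale t (wedge (A *v b) a) = congruent_matrix (mat 1 + mat_scale t (outer a b)) A"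
proof -
  let ?g = "mat_scale t (outer a b)"
  have 1: "?g ** A = mat_scale t (outer a (- (A *v b)))"
  proof -
    have "(\<Sum>k\<in>UNIV. t * (a $ i * b $ k) * A $ k $ j) = t * (a $ i * (- (\<Sum>k\<in>UNIV. A $ j $ k * b $ k)))" for i j
      unfolding sum_negf[symmetric] sum_distrib_left
      by (intro sum.cong refl) (subst skew_swap[OF A], simp add: algebra_simps)
    then show ?thesis
      by (simp add: vec_eq_iff matrix_matrix_mult_def matrix_vector_mult_def outer_def)
  qed
  have 2: "A ** transpose ?g = mat_scale t (outer (A *v b) a)"
  proof -
    have "(\<Sum>k\<in>UNIV. A $ i $ k * (t * (a $ j * b $ k))) = t * ((\<Sum>k\<in>UNIV. A $ i $ k * b $ k) * a $ j)" for i j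
      unfolding sum_distrib_left sum_distrib_right
      by (intro sum.cong refl) (simp add: algebra_simps)
    then show ?thesis
      by (simp add: vec_eq_iff matrix_matrix_mult_def matrix_vector_mult_def outer_def transpose_def)
  qed
  have 3: "?g ** A ** transpose ?g = 0"
  proof -
    have "(\<Sum>k\<in>UNIV. t * (a $ i * b $ k) * (t * ((\<Sum>l\<in>UNIV. A $ k $ l * b $ l) * a $ j))) =
        t * t * a $ i * a $ j * (\<Sum>k\<in>UNIV. \<Sum>l\<in>UNIV. b $ k * A $ k $ l * b $ l)" for i j
      unfolding sum_distrib_left sum_distrib_right
      by (intro sum.cong refl) (simp add: algebra_simps)
    then have "?g ** (A ** transpose ?g) = 0"
      unfolding 2 skew_quadratic_form[OF A]
      by (simp add: vec_eq_iff matrix_matrix_mult_def matrix_vector_mult_def outer_def)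
    then show ?thesis
      by (simp add: matrix_mul_assoc)
  qed
  have "congruent_matrix (mat 1 + ?g) A = A + A ** transpose ?g + (?g ** A + ?g ** A ** transpose ?g)"
    unfolding congruent_matrix_def transpose_arith
    by (simp add: matrix_add_ldistrib matrix_add_rdistrib)
  also have "\<dots> = A + mat_scale t (wedge (A *v b) a)"
    unfolding 3[unfolded 1] 1 2 by (simp add: vec_eq_iff outer_def wedge_component algebra_simps)
  finally show ?thesis ..
qed

lemma wedge_in_tangent_space:
  fixes x :: "'a::alg_closed_field^'n^'n"
  assumes "x \<in> skew_determinantal r"
  shows "wedge (x *v b) a \<in> tangent_space mat_scale skew_matrices (skew_determinantal r) x"
proof (rule line_in_tangent_space)
  fix t
  have "x \<in> skew_matrices" "rank x \<le> r"
    using assms by (auto simp: skew_determinantal_def)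
  then show "x + mat_scale t (wedge (x *v b) a) \<in> skew_determinantal r"
    using rank_congruent_le[of "mat 1 + mat_scale t (outer a b)" x]
    by (simp add: add_wedge_congruent skew_determinantal_def skew_congruent)
qed (rule skew_wedge)

lemma congruent_wedge: "congruent_matrix P (wedge u a) = wedge (P *v u) (P *v a)"
proof -
  have "(\<Sum>l\<in>UNIV. (\<Sum>k\<in>UNIV. P $ i $ k * (u $ k * a $ l - a $ k * u $ l)) * P $ j $ l) =
      (\<Sum>k\<in>UNIV. P $ i $ k * u $ k) * (\<Sum>l\<in>UNIV. P $ j $ l * a $ l) -
      (\<Sum>k\<in>UNIV. P $ i $ k * a $ k) * (\<Sum>l\<in>UNIV. P $ j $ l * u $ l)" for i j
  proof -
    have "(\<Sum>k\<in>UNIV. P $ i $ k * (u $ k * a $ l - a $ k * u $ l)) * P $ j $ l =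
        (\<Sum>k\<in>UNIV. P $ i $ k * u $ k) * (P $ j $ l * a $ l) -
        (\<Sum>k\<in>UNIV. P $ i $ k * a $ k) * (P $ j $ l * u $ l)" for l
      unfolding sum_distrib_right sum_subtractf[symmetric]
      by (intro sum.cong refl) (simp add: algebra_simps)
    then show ?thesis
      by (simp only: sum_subtractf sum_distrib_left)
  qed
  then show ?thesis
    by (simp add: vec_eq_iff congruent_matrix_component wedge_component matrix_vector_mult_def)
qed

lemma polyfun_skew_comp:
  fixes h :: "'v::ab_group_add \<Rightarrow> 'a::field^'n^'n"
  assumes p: "p \<in> polyfun mat_scale skew_matrices"
    and h: "\<And>i j. (\<lambda>x. h x $ i $ j) \<in> polyfun s V" "\<And>x. h x \<in> skew_matrices"
  shows "(\<lambda>x. p (h x)) \<in> polyfun s V"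
  using p
proof (rule polyfun_comp)
  fix l :: "'a^'n^'n \<Rightarrow> 'a"
  assume l: "linear_form mat_scale skew_matrices l"
  obtain ord :: "'n \<Rightarrow> nat" where ord: "inj ord"
    using finite_imp_inj_to_nat_seg[of "UNIV :: 'n set"] by auto
  have "l (h x) = (\<Sum>e | ord (fst e) < ord (snd e). h x $ fst e $ snd e * l (unit_wedge (fst e) (snd e)))" for x
  proof -
    have "l (h x) = l (\<Sum>e | ord (fst e) < ord (snd e). mat_scale (h x $ fst e $ snd e) (unit_wedge (fst e) (snd e)))"
      using skew_expand[OF h(2) ord] by (rule arg_cong)
    also have "\<dots> = (\<Sum>e | ord (fst e) < ord (snd e). l (mat_scale (h x $ fst e $ snd e) (unit_wedge (fst e) (snd e))))"
      by (rule linear_form_sum[OF l vector_space_mat_scale subspace_skew_matrices])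
        (intro skew_scale skew_wedge)
    finally show ?thesis
      using l by (simp add: linear_form_def skew_wedge)
  qed
  then show "(\<lambda>x. l (h x)) \<in> polyfun s V"
    by (simp add: polyfun_sum polyfun.mult polyfun.const h(1))
qed

section \<open>Smooth points of determinantal varieties\<close>

text \<open>The projection onto the coordinates in \<open>I\<close>, as a diagonal matrix.\<close>

definition coord_projection :: "'n set \<Rightarrow> 'a::field^'n^'n" where
  "coord_projection I = (\<chi> i j. if i = j \<and> i \<in> I then 1 else 0)"

lemma coord_projection_mult:
  fixes M :: "'a::field^'n^'n"
  shows "(coord_projection I ** M) $ i $ j = (if i \<in> I then M $ i $ j else 0)"
    "(M ** coord_projection I) $ i $ j = (if j \<in> I then M $ i $ j else 0)"
proof -
  have "(\<Sum>k\<in>UNIV. (if i = k \<and> i \<in> I then 1 else 0) * M $ k $ j) =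
      (\<Sum>k\<in>UNIV. if k = i then (if i \<in> I then M $ i $ j else 0) else 0)"
    by (intro sum.cong) auto
  then show "(coord_projection I ** M) $ i $ j = (if i \<in> I then M $ i $ j else 0)"
    by (simp add: coord_projection_def matrix_matrix_mult_def)
  have "(\<Sum>k\<in>UNIV. M $ i $ k * (if k = j \<and> k \<in> I then 1 else 0)) =
      (\<Sum>k\<in>UNIV. if k = j then (if j \<in> I then M $ i $ j else 0) else 0)"
    by (intro sum.cong) auto
  then show "(M ** coord_projection I) $ i $ j = (if j \<in> I then M $ i $ j else 0)"
    by (simp add: coord_projection_def matrix_matrix_mult_def)
qed

lemma transpose_coord_projection: "transpose (coord_projection I) = coord_projection I"
  by (auto simp: coord_projection_def transpose_def vec_eq_iff)

lemma coord_projection_vector: "(coord_projection I *v y) $ i = (if i \<in> I then y $ i else 0)"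
proof -
  have "(\<Sum>k\<in>UNIV. (if i = k \<and> i \<in> I then 1 else 0) * y $ k) =
      (\<Sum>k\<in>UNIV. if k = i then (if i \<in> I then y $ i else 0) else 0)"
    by (intro sum.cong) auto
  then show ?thesis
    by (simp add: coord_projection_def matrix_vector_mult_def)
qed

lemma unit_wedge_mult:
  fixes M :: "'a::field^'n^'n"
  shows "(unit_wedge a b ** M) $ i $ j = (if i = a then M $ b $ j else 0) - (if i = b then M $ a $ j else 0)"
proof -
  have mult: "((if P then 1 else 0) - (if Q then 1 else 0)) * x = (if P then x else 0) - (if Q then x else 0)"
    for P Q and x :: 'a
    by (cases P; cases Q) simp_all
  have delta: "(\<Sum>k\<in>UNIV. if i = c \<and> k = d then M $ k $ j else 0) = (if i = c then M $ d $ j else 0)" for c d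
    by (cases "i = c") simp_all
  show ?thesis
    unfolding matrix_matrix_mult_def unit_wedge_component vec_lambda_beta mult sum_subtractf delta ..
qed

text \<open>An even number of coordinates carries a nondegenerate alternating form \<open>J\<close>.\<close>

lemma symplectic_form_exists:
  fixes I :: "'n::finite set"
  assumes "even (card I)"
  obtains J :: "'a::field^'n^'n" where "J \<in> skew_matrices" "\<And>i j. i \<notin> I \<Longrightarrow> J $ i $ j = 0"
    "J ** J = - coord_projection I"
proof -
  have "\<exists>J :: 'a^'n^'n. J \<in> skew_matrices \<and> (\<forall>i j. i \<notin> I \<longrightarrow> J $ i $ j = 0) \<and>
      J ** J = - coord_projection I"
    using assms
  proof (induction "card I" arbitrary: I rule: less_induct)
    case less
    show ?case
    proof (cases "I = {}")
      case True
      then show ?thesis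
        by (intro exI[of _ 0]) (simp add: skew_zero matrix_mult_0 coord_projection_def vec_eq_iff)
    next
      case False
      then obtain a where a: "a \<in> I"
        by blast
      have "I \<noteq> {a}"
        using less.prems by auto
      then obtain b where b: "b \<in> I" "b \<noteq> a"
        using a by blast
      let ?I = "I - {a, b}"
      have "card I = card ?I + 2"
      proof -
        have "card (insert a (insert b ?I)) = card ?I + 2"
          using b by simp
        moreover have "insert a (insert b ?I) = I"
          using a b by blast
        ultimately show ?thesis
          by simp
      qed
      then have "\<exists>J :: 'a^'n^'n. J \<in> skew_matrices \<and> (\<forall>i j. i \<notin> ?I \<longrightarrow> J $ i $ j = 0) \<and>
          J ** J = - coord_projection ?I"
        using less.prems by (intro less.hyps) auto
      then obtain J :: "'a^'n^'n" where J: "J \<in> skew_matrices" "\<And>i j. i \<notin> ?I \<Longrightarrow> J $ i $ j = 0"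
          "J ** J = - coord_projection ?I"
        by blast
      let ?F = "unit_wedge a b :: 'a^'n^'n"
      have FJ: "?F ** J = 0"
        by (simp add: vec_eq_iff unit_wedge_mult J(2))
      have "J ** ?F = transpose (?F ** J)"
        unfolding matrix_transpose_mul skew_transpose[OF J(1)] skew_transpose[OF skew_wedge]
        by (simp add: matrix_mult_uminus)
      then have JF: "J ** ?F = 0"
        unfolding FJ by (simp add: transpose_def vec_eq_iff)
      have "(J + ?F) ** (J + ?F) = - coord_projection ?I + ?F ** ?F"
        by (simp add: matrix_add_ldistrib matrix_add_rdistrib J(3) FJ JF)
      also have "\<dots> = - coord_projection I"
      proof -
        have "(?F ** ?F) $ i $ j = - (if i = j \<and> i \<in> {a, b} then 1 else 0)" for i j
        proof -
          consider "i = a" | "i = b" | "i \<noteq> a" "i \<noteq> b"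
            by blast
          then show ?thesis
            unfolding unit_wedge_mult
            by cases (use b in \<open>auto simp: unit_wedge_component\<close>)
        qed
        then show ?thesis
          using a b by (auto simp: vec_eq_iff coord_projection_def)
      qed
      finally show ?thesis
        using J(1,2) a b by (intro exI[of _ "J + ?F"]) (auto simp: skew_add skew_wedge unit_wedge_component)
    qed
  qed
  then show ?thesis
    using that by blast
qed

text \<open>
  A point \<open>P J P\<^sup>T\<close> of rank \<open>|I|\<close>, where \<open>Q\<close> is the inverse of \<open>P\<close>. The map \<open>ord\<close> orders the
  coordinates such that those in \<open>I\<close> come first; it serves to select the positions above the diagonal.
\<close>

locale normal_point =
  fixes P Q J :: "'a::alg_closed_field^'n^'n" and I :: "'n set" and ord :: "'n \<Rightarrow> nat"
  assumes QP: "Q ** P = mat 1" and PQ: "P ** Q = mat 1"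
    and J_skew: "J \<in> skew_matrices" and J_outside: "\<And>i j. i \<notin> I \<Longrightarrow> J $ i $ j = 0"
    and J_square: "J ** J = - coord_projection I"
    and inj_ord: "inj ord" and ord_less: "\<And>i j. i \<in> I \<Longrightarrow> j \<notin> I \<Longrightarrow> ord i < ord j"
begin

abbreviation Z :: "('a^'n^'n) set" where
  "Z \<equiv> skew_determinantal (card I)"

abbreviation point :: "'a^'n^'n" where
  "point \<equiv> congruent_matrix P J"

text \<open>
  The positions above the diagonal in the rows from \<open>I\<close>. They index a basis of the tangent space and
  the parameters near the point.
\<close>

definition E :: "('n \<times> 'n) set" where
  "E = {e. ord (fst e) < ord (snd e) \<and> fst e \<in> I}"

lemma J_outside_column: "j \<notin> I \<Longrightarrow> J $ i $ j = 0"
  using skew_swap[OF J_skew, of i j] J_outside by simp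

lemma congruent_QP [simp]: "congruent_matrix Q (congruent_matrix P M) = M"
  by (simp add: congruent_matrix_compose QP congruent_matrix_1)

lemma congruent_PQ [simp]: "congruent_matrix P (congruent_matrix Q M) = M"
  by (simp add: congruent_matrix_compose PQ congruent_matrix_1)

lemma rank_J: "rank J \<le> card I"
  by (rule rank_le_card_rows) (simp add: row_def vec_eq_iff J_outside)

lemma point_in_Z: "point \<in> Z"
  using rank_congruent_le[of P J] rank_J J_skew by (simp add: skew_determinantal_def skew_congruent)

lemma projection_J: "coord_projection I ** J = J"
  by (simp add: vec_eq_iff coord_projection_mult J_outside)

lemma J_projection: "J ** coord_projection I = J"
  by (simp add: vec_eq_iff coord_projection_mult J_outside_column)

subsection \<open>The tangent space\<close>

lemma unit_wedge_tangent:
  assumes "i \<in> I"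
  shows "congruent_matrix P (unit_wedge i j) \<in> tangent_space mat_scale skew_matrices Z point"
proof -
  \<comment> \<open>\<open>P e\<^sub>i\<close> is the image of \<open>- Q\<^sup>T J e\<^sub>i\<close> under \<open>P J P\<^sup>T\<close>, as \<open>J\<^sup>2\<close> is minus the projection\<close>
  have "transpose P ** transpose Q = mat 1"
    using QP by (metis matrix_transpose_mul transpose_mat)
  then have "point ** (- (transpose Q ** J)) = P ** coord_projection I"
    unfolding congruent_matrix_def
    by (metis (no_types, opaque_lifting) J_square matrix_mul_assoc matrix_mul_lid matrix_mult_uminus(2) minus_minus)
  then have "point *v ((- (transpose Q ** J)) *v axis i 1) = P *v (coord_projection I *v axis i 1)"
    by (simp only: matrix_vector_mul_assoc)
  also have "coord_projection I *v axis i 1 = (axis i 1 :: 'a^'n)"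
    using assms by (auto simp: vec_eq_iff coord_projection_vector axis_def)
  finally show ?thesis
    using wedge_in_tangent_space[OF point_in_Z, of "(- (transpose Q ** J)) *v axis i 1" "P *v axis j 1"]
    by (simp add: congruent_wedge)
qed

text \<open>
  For distinct \<open>k, l\<close> outside \<open>I\<close>, with \<open>r = |I|\<close>, a matrix \<open>D\<close> of rank \<open>n - r - 1\<close> is chosen such that
  row \<open>k\<close> and column \<open>l\<close> of \<open>J + D\<close> vanish. Then \<open>det (M + D)\<close> vanishes on the matrices \<open>M\<close> of rank at
  most \<open>r\<close>, and its derivative at \<open>J\<close> in the direction \<open>w\<close> is, up to a nonzero constant, \<open>w $ k $ l\<close>.
\<close>

lemma tangent_entry_eq_0:
  assumes v: "v \<in> tangent_space mat_scale skew_matrices Z point" and kl: "k \<notin> I" "l \<notin> I"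
  shows "congruent_matrix Q v $ k $ l = 0"
proof (cases "k = l")
  case True
  then show ?thesis
    using v skew_diag[OF skew_congruent] by (auto simp: tangent_space_def)
next
  case False
  define w where "w = congruent_matrix Q v"
  define \<tau> where "\<tau> = Transposition.transpose k l"
  define D :: "'a^'n^'n" where "D = (\<chi> a b. if a \<notin> I \<and> a \<noteq> k \<and> b = \<tau> a then 1 else 0)"
  define p where "p z = det (congruent_matrix Q z + D)" for z
  have "rank D \<le> card (- I - {k})"
    by (rule rank_le_card_rows) (auto simp: D_def row_def vec_eq_iff)
  also have "\<dots> < card (- I)"
    using kl(1) by (intro psubset_card_mono) auto
  also have "card (- I) = CARD('n) - card I"
    by (simp add: Compl_eq_Diff_UNIV card_Diff_subset)
  finally have rank_D: "card I + rank D < CARD('n)"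
    by simp
  have "p z = 0" if "z \<in> Z" for z
    unfolding p_def using that rank_congruent_le[of Q z] rank_D
    by (intro det_add_eq_0) (simp add: skew_determinantal_def)
  moreover have "p \<in> polyfun mat_scale skew_matrices"
    unfolding p_def
    by (rule polyfun_det) (simp add: polyfun.add polyfun_congruent_entry polyfun.const)
  ultimately have p: "p \<in> vanishing_ideal mat_scale skew_matrices Z"
    by (simp add: vanishing_ideal_def)
  \<comment> \<open>row \<open>k\<close> of \<open>J + t w + D\<close> is \<open>t\<close> times that of \<open>w\<close>; the determinant without this factor is \<open>g\<close>\<close>
  define g :: "'a^'n^'n \<Rightarrow> 'a" where "g z = det (\<chi> a. if a = k then row k w else row a z)" for z
  have "g \<in> polyfun mat_scale UNIV"
    unfolding g_def
  proof (rule polyfun_det)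
    fix i j
    show "(\<lambda>z. (\<chi> a. if a = k then row k w else row a z) $ i $ j) \<in> polyfun mat_scale UNIV"
      by (cases "i = k") (simp_all add: row_def polyfun.const polyfun_entry)
  qed
  then obtain q where q: "\<And>t. poly q t = g ((J + D) + mat_scale t w)"
    using dir_deriv_unique_poly[OF vector_space_mat_scale module.subspace_UNIV
        [OF vector_space_mat_scale[folded module_iff_vector_space]], of g "J + D" w] by auto
  have "poly (pCons 0 q) t = p (point + mat_scale t v)" for t
  proof -
    have "p (point + mat_scale t v) = det (J + mat_scale t w + D)"
      by (simp add: p_def congruent_matrix_add congruent_matrix_scale w_def)
    also have "J + mat_scale t w + D =
        (\<chi> a. if a = k then t *s row k w else row a ((J + D) + mat_scale t w))"
      using kl(1) by (auto simp: vec_eq_iff row_def D_def J_outside)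
    also have "det \<dots> = t * g ((J + D) + mat_scale t w)"
      unfolding g_def by (rule det_row_mul)
    finally show ?thesis
      by (simp add: q)
  qed
  then have "dir_deriv mat_scale p point v = coeff (pCons 0 q) 1"
    by (rule dir_deriv_eq)
  also have "\<dots> = poly q 0"
    by (simp add: poly_0_coeff_0)
  also have "\<dots> = g (J + D)"
    unfolding q by (rule arg_cong[of _ _ g]) (simp add: vec_eq_iff)
  finally have g0: "g (J + D) = 0"
    using v p by (simp add: tangent_space_def)
  show ?thesis
  proof (rule ccontr)
    assume nz: "congruent_matrix Q v $ k $ l \<noteq> 0"
    define G :: "'a^'n^'n" where "G = (\<chi> a. if a = k then row k w else row a (J + D))"
    have G_row: "(G *v y) $ a = (if a = k then (\<Sum>b\<in>UNIV. w $ k $ b * y $ b)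
        else (J *v y) $ a + (if a \<in> I then 0 else y $ \<tau> a))" for y a
    proof (cases "a = k")
      case True
      then show ?thesis
        by (simp add: G_def matrix_vector_mult_def row_def)
    next
      case False
      have "(\<Sum>b\<in>UNIV. D $ a $ b * y $ b) = (\<Sum>b\<in>UNIV. if b = \<tau> a then (if a \<in> I then 0 else y $ b) else 0)"
        using False by (intro sum.cong) (auto simp: D_def)
      then have "(\<Sum>b\<in>UNIV. D $ a $ b * y $ b) = (if a \<in> I then 0 else y $ \<tau> a)"
        by simp
      then show ?thesis
        using False by (simp add: G_def matrix_vector_mult_def row_def distrib_right sum.distrib)
    qed
    have "y = 0" if y: "G *v y = 0" for y
    proof -
      have rows: "(J *v y) $ a + (if a \<in> I then 0 else y $ \<tau> a) = 0" if "a \<noteq> k" for a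
        using G_row[of y a] that y by simp
      have Jy: "(J *v y) $ a = 0" for a
      proof (cases "a \<in> I")
        case True
        then show ?thesis
          using rows[of a] kl(1) by auto
      next
        case False
        then show ?thesis
          by (simp add: matrix_vector_mult_def J_outside)
      qed
      then have "J *v (J *v y) = 0"
        by (metis matrix_vector_mult_0_right vec_eq_iff zero_index)
      then have "coord_projection I *v y = 0"
        unfolding matrix_vector_mul_assoc J_square
        by (simp add: matrix_vector_mult_def vec_eq_iff sum_negf)
      then have yI: "y $ a = 0" if "a \<in> I" for a
        using that coord_projection_vector[of I y a] by simp
      have yO: "y $ b = 0" if "b \<notin> I" "b \<noteq> l" for b
      proof -
        have "\<tau> b \<noteq> k" "\<tau> b \<notin> I" "\<tau> (\<tau> b) = b"
          using that kl unfolding \<tau>_def by (auto simp: Transposition.transpose_def)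
        then show ?thesis
          using rows[of "\<tau> b"] Jy by simp
      qed
      have "(\<Sum>b\<in>UNIV. w $ k $ b * y $ b) = (\<Sum>b\<in>{l}. w $ k $ b * y $ b)"
        using yI yO by (intro sum.mono_neutral_right) auto
      then have "w $ k $ l * y $ l = 0"
        using G_row[of y k] y by simp
      then have "y $ l = 0"
        using nz by (simp add: w_def)
      then show ?thesis
        using yI yO by (metis vec_eq_iff zero_index)
    qed
    then have "\<exists>B. B ** G = mat 1"
      unfolding matrix_left_invertible_ker by blast
    then have "det G \<noteq> 0"
      unfolding invertible_left_inverse[symmetric] invertible_det_nz .
    then show False
      using g0 by (simp add: G_def g_def)
  qed
qed

lemma unit_wedge_entry:
  assumes "e \<in> E" "e' \<in> E"
  shows "unit_wedge (fst e') (snd e') $ fst e $ snd e = (if e' = e then 1 else 0 :: 'a)"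
proof -
  have "ord (fst e) < ord (snd e)" "ord (fst e') < ord (snd e')"
    using assms by (simp_all add: E_def)
  then have "\<not> (fst e = snd e' \<and> snd e = fst e')"
    by (metis less_asym)
  moreover have "(fst e = fst e' \<and> snd e = snd e') = (e' = e)"
    by (metis prod_eqI)
  ultimately show ?thesis
    unfolding unit_wedge_component by simp
qed

lemma tangent_expand:
  assumes v: "v \<in> tangent_space mat_scale skew_matrices Z point"
  obtains c where "v = (\<Sum>e\<in>E. mat_scale (c e) (congruent_matrix P (unit_wedge (fst e) (snd e))))"
proof -
  define w where "w = congruent_matrix Q v"
  have w: "w \<in> skew_matrices"
    using v unfolding w_def by (intro skew_congruent) (simp add: tangent_space_def)
  have "w = (\<Sum>e | ord (fst e) < ord (snd e). mat_scale (w $ fst e $ snd e) (unit_wedge (fst e) (snd e)))"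
    by (rule skew_expand[OF w inj_ord])
  also have "\<dots> = (\<Sum>e\<in>E. mat_scale (w $ fst e $ snd e) (unit_wedge (fst e) (snd e)))"
  proof (rule sum.mono_neutral_right)
    show "\<forall>e\<in>{e. ord (fst e) < ord (snd e)} - E.
        mat_scale (w $ fst e $ snd e) (unit_wedge (fst e) (snd e)) = 0"
    proof
      fix e assume e: "e \<in> {e. ord (fst e) < ord (snd e)} - E"
      then have "fst e \<notin> I" "snd e \<notin> I"
        using ord_less[of "snd e" "fst e"] by (auto simp: E_def)
      then have "w $ fst e $ snd e = 0"
        unfolding w_def using v by (intro tangent_entry_eq_0)
      then show "mat_scale (w $ fst e $ snd e) (unit_wedge (fst e) (snd e)) = 0"
        by (simp add: vec_eq_iff)
    qed
  qed (auto simp: E_def)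
  finally have "v = congruent_matrix P (\<Sum>e\<in>E. mat_scale (w $ fst e $ snd e) (unit_wedge (fst e) (snd e)))"
    by (metis congruent_PQ w_def)
  also have "\<dots> = (\<Sum>e\<in>E. mat_scale (w $ fst e $ snd e) (congruent_matrix P (unit_wedge (fst e) (snd e))))"
  proof -
    have "congruent_matrix P (\<Sum>e\<in>A. h e) = (\<Sum>e\<in>A. congruent_matrix P (h e))" for A :: "('n \<times> 'n) set" and h
      by (induction A rule: infinite_finite_induct) (simp_all add: congruent_matrix_0 congruent_matrix_add)
    then show ?thesis
      by (simp add: congruent_matrix_scale)
  qed
  finally show ?thesis
    by (rule that)
qed

lemma dim_tangent_space:
  "vector_space.dim mat_scale (tangent_space mat_scale skew_matrices Z point) = card E"
proof -
  interpret M: vector_space "mat_scale :: 'a \<Rightarrow> 'a^'n^'n \<Rightarrow> _"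
    by (rule vector_space_mat_scale)
  let ?b = "\<lambda>e. congruent_matrix P (unit_wedge (fst e) (snd e))"
  let ?T = "tangent_space mat_scale skew_matrices Z point"
  have dual: "congruent_matrix Q (?b e') $ fst e $ snd e = (if e' = e then 1 else 0)"
    if "e \<in> E" "e' \<in> E" for e e'
    using unit_wedge_entry[OF that] by simp
  have inj: "inj_on ?b E"
    by (rule inj_onI) (metis dual one_neq_zero)
  have "M.independent (?b ` E)"
  proof (rule M.independent_if_scalars_zero)
    fix f x assume f: "(\<Sum>x\<in>?b ` E. mat_scale (f x) x) = 0" and "x \<in> ?b ` E"
    then obtain e where e: "e \<in> E" "x = ?b e"
      by auto
    have lf: "linear_form mat_scale UNIV (\<lambda>z. congruent_matrix Q z $ fst e $ snd e)"
      by (simp add: linear_form_def congruent_matrix_add congruent_matrix_scale)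
    have "0 = congruent_matrix Q (\<Sum>e'\<in>E. mat_scale (f (?b e')) (?b e')) $ fst e $ snd e"
      using f by (simp add: sum.reindex[OF inj] congruent_matrix_0)
    also have "\<dots> = (\<Sum>e'\<in>E. congruent_matrix Q (mat_scale (f (?b e')) (?b e')) $ fst e $ snd e)"
      by (rule linear_form_sum[OF lf vector_space_mat_scale M.subspace_UNIV]) simp
    also have "\<dots> = (\<Sum>e'\<in>E. if e' = e then f x else 0)"
      using dual[OF e(1)] e(2) by (intro sum.cong refl) (simp add: congruent_matrix_scale)
    also have "\<dots> = f x"
      using e(1) by simp
    finally show "f x = 0"
      by simp
  qed simp
  moreover have "?b ` E \<subseteq> ?T"
    using unit_wedge_tangent by (auto simp: E_def)
  moreover have "?T \<subseteq> M.span (?b ` E)"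
  proof
    fix v assume "v \<in> ?T"
    then obtain c where "v = (\<Sum>e\<in>E. mat_scale (c e) (?b e))"
      by (rule tangent_expand)
    then show "v \<in> M.span (?b ` E)"
      by (simp add: M.span_sum M.span_scale M.span_base)
  qed
  ultimately have "M.dim ?T = card (?b ` E)"
    by (intro M.dim_unique) auto
  then show ?thesis
    using card_image[OF inj] by simp
qed

end

context normal_point
begin

subsection \<open>A parametrization\<close>

text \<open>
  In block form, let \<open>A\<close> be alternating and supported on \<open>I \<times> I\<close>, and let \<open>N\<close> be supported on the rows
  in \<open>I\<close> and the columns outside \<open>I\<close>. Then \<open>(1 + N)\<^sup>T A (1 + N)\<close> has rank at most \<open>|I|\<close>, the upper left
  block \<open>A\<close> and the upper right block \<open>A N\<close>. The parameters are the entries of \<open>A - J\<close> above the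
  diagonal and those of \<open>N\<close>; the matrix \<open>block_R\<close> is \<open>(1 + N)\<^sup>T\<close>.
\<close>

definition block_A :: "('n \<times> 'n \<Rightarrow> 'a) \<Rightarrow> 'a^'n^'n" where
  "block_A t = (\<chi> i j. J $ i $ j + (if i \<in> I \<and> j \<in> I then t (i, j) - t (j, i) else 0))"

definition block_R :: "('n \<times> 'n \<Rightarrow> 'a) \<Rightarrow> 'a^'n^'n" where
  "block_R t = (\<chi> j i. (if i = j then 1 else 0) + (if i \<in> I \<and> j \<notin> I then t (i, j) else 0))"

definition \<Phi> :: "('n \<times> 'n \<Rightarrow> 'a) \<Rightarrow> 'a^'n^'n" where
  "\<Phi> t = congruent_matrix P (congruent_matrix (block_R t) (block_A t))"

lemma skew_block_A: "block_A t \<in> skew_matrices"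
proof -
  have "block_A t $ i $ j = - block_A t $ j $ i" for i j
    unfolding block_A_def vec_lambda_beta by (subst skew_swap[OF J_skew]) simp
  moreover have "block_A t $ i $ i = 0" for i
    by (simp add: block_A_def skew_diag[OF J_skew])
  ultimately show ?thesis
    unfolding skew_matrices_iff by blast
qed

lemma skew_\<Phi>: "\<Phi> t \<in> skew_matrices"
  unfolding \<Phi>_def by (intro skew_congruent skew_block_A)

lemma \<Phi>_in_Z: "\<Phi> t \<in> Z"
proof -
  have "rank (block_A t) \<le> card I"
    by (rule rank_le_card_rows) (simp add: row_def vec_eq_iff block_A_def J_outside)
  then have "rank (\<Phi> t) \<le> card I"
    unfolding \<Phi>_def by (meson order_trans rank_congruent_le)
  then show ?thesis
    by (simp add: skew_determinantal_def skew_\<Phi>)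
qed

lemma \<Phi>_zero: "\<Phi> (\<lambda>_. 0) = point"
proof -
  have "block_A (\<lambda>_. 0) = J"
    by (simp add: block_A_def vec_eq_iff)
  moreover have "block_R (\<lambda>_. 0) = mat 1"
    by (auto simp: block_R_def mat_def vec_eq_iff)
  ultimately show ?thesis
    by (simp add: \<Phi>_def congruent_matrix_1)
qed

lemma polyfun_\<Phi>:
  assumes "p \<in> polyfun mat_scale skew_matrices"
  shows "(\<lambda>t. p (\<Phi> t)) \<in> polyfun dual_scale (coord_space E)"
  using assms
proof (rule polyfun_skew_comp)
  have A: "(\<lambda>t. block_A t $ i $ j) \<in> polyfun dual_scale (coord_space E)" for i j
    unfolding block_A_def
    by (cases "i \<in> I \<and> j \<in> I")
      (auto intro!: polyfun.add polyfun_diff polyfun.const polyfun_coordinate)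
  have R: "(\<lambda>t. block_R t $ i $ j) \<in> polyfun dual_scale (coord_space E)" for i j
    unfolding block_R_def
    by (cases "j \<in> I \<and> i \<notin> I") (auto intro!: polyfun.add polyfun.const polyfun_coordinate)
  have "\<Phi> t = congruent_matrix (P ** block_R t) (block_A t)" for t
    by (simp add: \<Phi>_def congruent_matrix_compose)
  moreover have "(\<lambda>t. (P ** block_R t) $ i $ j) \<in> polyfun dual_scale (coord_space E)" for i j
    unfolding matrix_matrix_mult_def by (simp add: polyfun_sum polyfun.mult polyfun.const R)
  ultimately show "(\<lambda>t. \<Phi> t $ i $ j) \<in> polyfun dual_scale (coord_space E)" for i j
    by (simp add: congruent_matrix_component polyfun_sum polyfun.mult A)
qed (rule skew_\<Phi>)

text \<open>
  The parameters are read off from the rows in \<open>I\<close>. For the entries of \<open>N\<close> this is linear when \<open>A = J\<close>,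
  as \<open>J (J N) = - N\<close>.
\<close>

lemma projection_R: "coord_projection I ** block_R t = coord_projection I"
  by (simp add: vec_eq_iff coord_projection_mult) (auto simp: block_R_def coord_projection_def)

lemma projection_A: "coord_projection I ** block_A t = block_A t"
  by (auto simp: vec_eq_iff coord_projection_mult block_A_def J_outside)

lemma A_projection: "block_A t ** coord_projection I = block_A t"
  by (auto simp: vec_eq_iff coord_projection_mult block_A_def J_outside_column)

lemma projection_congruent:
  "coord_projection I ** congruent_matrix (block_R t) (block_A t) = block_A t ** transpose (block_R t)"
proof -
  have "coord_projection I ** congruent_matrix (block_R t) (block_A t) =
      coord_projection I ** block_R t ** block_A t ** transpose (block_R t)"
    by (simp add: congruent_matrix_def matrix_mul_assoc)
  then show ?thesis
    by (simp add: projection_R projection_A)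
qed

lemma R_transpose_projection: "transpose (block_R t) ** coord_projection I = coord_projection I"
  using arg_cong[OF projection_R, of transpose t]
  by (simp add: matrix_transpose_mul transpose_coord_projection)

lemma congruent_upper_left:
  assumes "i \<in> I" "j \<in> I"
  shows "congruent_matrix Q (\<Phi> t) $ i $ j = J $ i $ j + t (i, j) - t (j, i)"
proof -
  let ?M = "congruent_matrix (block_R t) (block_A t)"
  have "coord_projection I ** ?M ** coord_projection I = block_A t"
    unfolding projection_congruent
    by (simp add: R_transpose_projection A_projection flip: matrix_mul_assoc)
  then have "?M $ i $ j = block_A t $ i $ j"
    using assms by (metis coord_projection_mult)
  then show ?thesis
    using assms by (simp add: \<Phi>_def block_A_def)
qed

lemma congruent_upper_right:
  assumes "i \<in> I" "j \<notin> I" and t: "\<And>i j. i \<in> I \<Longrightarrow> j \<in> I \<Longrightarrow> t (i, j) = 0"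
  shows "(J ** congruent_matrix Q (\<Phi> t)) $ i $ j = - t (i, j)"
proof -
  let ?M = "congruent_matrix (block_R t) (block_A t)"
  have "block_A t = J"
    using t by (simp add: block_A_def vec_eq_iff)
  then have "J ** ?M = - (coord_projection I ** transpose (block_R t))"
    by (metis J_projection J_square matrix_mul_assoc matrix_mult_uminus(1) projection_congruent)
  moreover have "i \<noteq> j"
    using assms by auto
  ultimately show ?thesis
    using assms by (simp add: \<Phi>_def coord_projection_mult) (simp add: transpose_def block_R_def)
qed

text \<open>
  The determinant of the upper left block of \<open>Q z Q\<^sup>T\<close>. The parametrized neighbourhood of the point is
  the set where it is nonzero.
\<close>

definition block_det :: "'a^'n^'n \<Rightarrow> 'a" where
  "block_det z = det (\<chi> i j. if i \<in> I \<and> j \<in> I then congruent_matrix Q z $ i $ j else if i = j then 1 else 0)"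

lemma polyfun_block_det: "block_det \<in> polyfun mat_scale skew_matrices"
  unfolding block_det_def
proof (rule polyfun_det)
  fix i j
  show "(\<lambda>z. (\<chi> i j. if i \<in> I \<and> j \<in> I then congruent_matrix Q z $ i $ j else if i = j then 1 else 0) $ i $ j)
      \<in> polyfun mat_scale skew_matrices"
    by (cases "i \<in> I \<and> j \<in> I") (auto intro: polyfun_congruent_entry polyfun.const)
qed

lemma block_det_point: "block_det point \<noteq> 0"
proof -
  define M where "M = J + (mat 1 - coord_projection I)"
  have pp: "coord_projection I ** coord_projection I = (coord_projection I :: 'a^'n^'n)"
    by (simp add: vec_eq_iff coord_projection_mult) (simp add: coord_projection_def)
  have "M ** (mat 1 - coord_projection I - J) = mat 1"
    unfolding M_def
    by (simp add: matrix_add_rdistrib matrix_mult_diff J_square projection_J J_projection pp)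
  then have "det M \<noteq> 0"
    by (metis det_I det_mul mult_zero_left zero_neq_one)
  moreover have "M = (\<chi> i j. if i \<in> I \<and> j \<in> I then J $ i $ j else if i = j then 1 else 0)"
    by (auto simp: M_def vec_eq_iff mat_def coord_projection_def J_outside J_outside_column)
  ultimately show ?thesis
    unfolding block_det_def congruent_QP by simp
qed

text \<open>
  Where the upper left block of \<open>M = Q z Q\<^sup>T\<close> is invertible, the rows in \<open>I\<close> span the row space. This
  gives \<open>M = Y M\<close> with \<open>Y\<close> supported on the columns in \<open>I\<close>, and therefore \<open>M = Y M Y\<^sup>T\<close>.
\<close>

lemma \<Phi>_surj:
  assumes z: "z \<in> Z" "block_det z \<noteq> 0"
  shows "z \<in> \<Phi> ` coord_space E"
proof -
  define M where "M = congruent_matrix Q z"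
  have M: "M \<in> skew_matrices" "rank M \<le> card I"
    using z(1) rank_congruent_le[of Q z] unfolding M_def
    by (auto simp: skew_determinantal_def skew_congruent)
  define G where "G = (\<chi> i j. if i \<in> I \<and> j \<in> I then M $ i $ j else if i = j then 1 else 0)"
  have "det G \<noteq> 0"
    using z(2) unfolding block_det_def G_def M_def .
  then obtain G' where G': "G ** G' = mat 1"
    unfolding invertible_det_nz[symmetric] invertible_right_inverse by blast
  have indep: "y = 0" if y: "\<And>i. i \<notin> I \<Longrightarrow> y $ i = 0" "y v* M = 0" for y
  proof -
    have "(y v* G) $ j = 0" for j
    proof (cases "j \<in> I")
      case True
      have "(y v* G) $ j = (y v* M) $ j"
        unfolding vector_matrix_mult_component
        by (intro sum.cong refl) (use True y(1) in \<open>auto simp: G_def\<close>)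
      then show ?thesis
        by (simp add: y(2))
    next
      case False
      show ?thesis
        unfolding vector_matrix_mult_component
        by (intro sum.neutral) (use False y(1) in \<open>auto simp: G_def\<close>)
    qed
    then have "y v* G = 0"
      by (simp add: vec_eq_iff)
    then have "y v* (G ** G') = 0"
      by (simp flip: vector_matrix_mul_assoc)
    then show "y = 0"
      by (simp add: G')
  qed
  have "\<exists>y. (\<forall>i. i \<notin> I \<longrightarrow> y $ i = 0) \<and> row l M = y v* M" for l
    using row_in_span[OF M(2) indep, of l] by metis
  then obtain y where y: "\<And>l i. i \<notin> I \<Longrightarrow> y l $ i = 0" "\<And>l. row l M = y l v* M"
    by metis
  define t where "t e = (if e \<in> E then if snd e \<in> I then M $ fst e $ snd e - J $ fst e $ snd e
      else y (snd e) $ fst e else 0)" for e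
  have t: "t \<in> coord_space E"
    by (simp add: t_def coord_space_def)
  have A: "block_A t = coord_projection I ** M ** coord_projection I"
  proof -
    have "block_A t $ i $ j = M $ i $ j" if "i \<in> I" "j \<in> I" for i j
    proof -
      consider "i = j" | "ord i < ord j" | "ord j < ord i"
        using injD[OF inj_ord, of i j] by linarith
      then show ?thesis
      proof cases
        case 1
        then show ?thesis
          using skew_diag[OF M(1)] skew_diag[OF J_skew] by (simp add: block_A_def)
      next
        case 2
        then show ?thesis
          using that by (simp add: block_A_def t_def E_def)
      next
        case 3
        then show ?thesis
          using that skew_swap[OF M(1), of i j] skew_swap[OF J_skew, of i j]
          by (simp add: block_A_def t_def E_def)
      qed
    qed
    moreover have "block_A t $ i $ j = 0" if "\<not> (i \<in> I \<and> j \<in> I)" for i j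
      using that by (auto simp: block_A_def J_outside J_outside_column)
    ultimately show ?thesis
      by (auto simp: vec_eq_iff coord_projection_mult)
  qed
  define Y where "Y = block_R t ** coord_projection I"
  have "M = Y ** M"
  proof -
    have "row l (Y ** M) = row l M" for l
    proof (cases "l \<in> I")
      case True
      then have "row l Y = axis l 1"
        by (auto simp: vec_eq_iff row_def Y_def coord_projection_mult block_R_def axis_def)
      then show ?thesis
        by (metis axis_vector_matrix_mult vector_matrix_mul_assoc)
    next
      case False
      then have "row l Y = y l"
        using y(1) ord_less by (auto simp: vec_eq_iff row_def Y_def coord_projection_mult block_R_def t_def E_def)
      then show ?thesis
        by (metis axis_vector_matrix_mult vector_matrix_mul_assoc y(2))
    qed
    then show ?thesis
      by (simp add: vec_eq_iff row_def)
  qed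
  moreover from this have "M = M ** transpose Y"
    by (metis M(1) matrix_mult_uminus(1) matrix_transpose_mul minus_minus skew_transpose)
  ultimately have "M = Y ** M ** transpose Y"
    by (metis matrix_mul_assoc)
  also have "\<dots> = congruent_matrix (block_R t) (block_A t)"
    unfolding A Y_def congruent_matrix_def matrix_transpose_mul transpose_coord_projection
    by (simp add: matrix_mul_assoc)
  finally have "z = \<Phi> t"
    unfolding \<Phi>_def M_def by (metis congruent_PQ)
  then show ?thesis
    using t by blast
qed

lemma local_dim_point: "local_dim mat_scale skew_matrices Z point = enat (card E)"
proof -
  \<comment> \<open>the entries of \<open>N\<close>, in \<open>E1\<close>, come first, so that \<open>A = J\<close> as long as only these are nonzero\<close>
  define E1 where "E1 = {e\<in>E. snd e \<notin> I}"
  define E2 where "E2 = {e\<in>E. snd e \<in> I}"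
  obtain es1 es2 where es1: "set es1 = E1" "distinct es1" and es2: "set es2 = E2" "distinct es2"
    using finite_distinct_list[of E1] finite_distinct_list[of E2] by auto
  define es where "es = es1 @ es2"
  have es: "set es = E" "distinct es"
    using es1 es2 by (auto simp: es_def E1_def E2_def)
  define f where "f e z = (if snd e \<in> I then congruent_matrix Q z $ fst e $ snd e - J $ fst e $ snd e
      else (J ** congruent_matrix Q z) $ fst e $ snd e)" for e z
  have poly_f: "f e \<in> polyfun mat_scale skew_matrices" for e
  proof (cases "snd e \<in> I")
    case True
    then show ?thesis
      unfolding f_def[abs_def] by (simp add: polyfun_diff polyfun_congruent_entry polyfun.const)
  next
    case False
    then show ?thesis
      unfolding f_def[abs_def] matrix_matrix_mult_def
      by (simp add: polyfun_sum polyfun.mult polyfun_congruent_entry polyfun.const)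
  qed
  have f2: "f e (\<Phi> t) = t e" if "e \<in> E2" "t \<in> coord_space E" for e t
  proof -
    have "(snd e, fst e) \<notin> E"
      using that(1) by (auto simp: E2_def E_def)
    then have "t (snd e, fst e) = 0"
      using that(2) by (simp add: coord_space_def)
    moreover have "fst e \<in> I" "snd e \<in> I"
      using that(1) by (auto simp: E2_def E_def)
    ultimately show ?thesis
      by (simp add: f_def congruent_upper_left)
  qed
  have f1: "f e (\<Phi> t) = - t e" if "e \<in> E1" "t \<in> coord_space E1" for e t
  proof -
    have "t (i, j) = 0" if "i \<in> I" "j \<in> I" for i j
      using that \<open>t \<in> coord_space E1\<close> by (simp add: coord_space_def E1_def)
    moreover have "fst e \<in> I" "snd e \<notin> I"
      using that(1) by (auto simp: E1_def E_def)
    ultimately show ?thesis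
      by (simp add: f_def congruent_upper_right)
  qed
  have f: "(f (es ! k) (\<Phi> t) = 0) = (t (es ! k) = 0)"
    if k: "k < length es" and t: "t \<in> coord_space (set (take (Suc k) es))" for k t
  proof (cases "k < length es1")
    case True
    then have "es ! k \<in> E1" "set (take (Suc k) es) \<subseteq> E1"
      using es1(1) set_take_subset[of "Suc k" es1] by (auto simp: es_def nth_append)
    moreover from this have "t \<in> coord_space E1"
      using t coord_space_mono by blast
    ultimately show ?thesis
      using f1[of "es ! k" t] by simp
  next
    case False
    then have "es ! k \<in> E2"
      using k es2(1) by (auto simp: es_def nth_append)
    moreover have "t \<in> coord_space E"
      using t coord_space_mono[OF set_take_subset[of "Suc k" es]] es(1) by auto
    ultimately show ?thesis
      using f2 by simp
  qed
  have "local_dim mat_scale skew_matrices Z point = enat (card (set es))"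
  proof (rule local_dim_parametrized[of es _ _ \<Phi> _ _ block_det "\<lambda>k. f (es ! k)"])
    show "(\<lambda>t. p (\<Phi> t)) \<in> polyfun dual_scale (coord_space (set es))"
      if "p \<in> polyfun mat_scale skew_matrices" for p
      unfolding es(1) using that by (rule polyfun_\<Phi>)
    show "\<Phi> ` coord_space (set es) \<subseteq> Z"
      using \<Phi>_in_Z by blast
    show "z \<in> \<Phi> ` coord_space (set es)" if "z \<in> Z" "block_det z \<noteq> 0" for z
      unfolding es(1) using that by (rule \<Phi>_surj)
    fix k assume k: "k < length es"
    show "f (es ! k) (\<Phi> t) = 0" if t: "t \<in> coord_space (set (take k es))" for t
    proof -
      have "es ! k \<notin> set (take k es)"
        using es(2) k by (simp add: distinct_conv_nth in_set_conv_nth)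
      then have "t (es ! k) = 0"
        using t unfolding coord_space_def by blast
      moreover have "t \<in> coord_space (set (take (Suc k) es))"
        using t coord_space_mono[OF set_take_subset_set_take[of k "Suc k" es]] by auto
      ultimately show ?thesis
        using f[OF k] by blast
    qed
    let ?t = "\<lambda>e. if e = es ! k then 1 else 0 :: 'a"
    have "?t \<in> coord_space (set (take (Suc k) es))"
      using k by (auto simp: coord_space_def take_Suc_conv_app_nth)
    then show "\<exists>t\<in>coord_space (set (take (Suc k) es)). f (es ! k) (\<Phi> t) \<noteq> 0"
      using f[OF k, of ?t] by (intro bexI[of _ ?t]) auto
  qed (rule es(2) zariski_closed_skew_determinantal \<Phi>_zero polyfun_block_det block_det_point poly_f)+
  then show ?thesis
    by (simp add: es(1))
qed

lemma smooth_point_congruent: "smooth_point mat_scale skew_matrices Z point"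
  unfolding smooth_point_def by (simp add: point_in_Z dim_tangent_space local_dim_point)

end

section \<open>The dual space\<close>

text \<open>
  The matrix of a functional on the alternating matrices has the values on the wedge products of basis
  vectors as entries. Conversely, the functional with matrix \<open>B\<close> maps \<open>A\<close> to the sum of the products
  \<open>A $ i $ j * B $ i $ j\<close> over the positions above the diagonal, for the order of the indices that is
  given by an injective map \<open>ord\<close>.
\<close>

definition dual_matrix :: "('a::field^'n^'n \<Rightarrow> 'a) \<Rightarrow> 'a^'n^'n" where
  "dual_matrix f = (\<chi> i j. f (unit_wedge i j))"

definition matrix_dual :: "('n \<Rightarrow> nat) \<Rightarrow> 'a::field^'n^'n \<Rightarrow> 'a^'n^'n \<Rightarrow> 'a" where
  "matrix_dual ord B A = (if A \<in> skew_matrices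
    then \<Sum>e | ord (fst e) < ord (snd e). A $ fst e $ snd e * B $ fst e $ snd e else 0)"

lemma dual_matrix_component: "dual_matrix f $ i $ j = f (unit_wedge i j)"
  by (simp add: dual_matrix_def)

lemma dual_spaceD: "f \<in> dual_space s V \<Longrightarrow> linear_form s V f"
  by (simp add: dual_space_def)

lemma skew_dual_matrix:
  fixes f :: "'a::field^'n^'n \<Rightarrow> 'a"
  assumes "linear_form mat_scale skew_matrices f"
  shows "dual_matrix f \<in> skew_matrices"
  unfolding skew_matrices_iff
proof (intro conjI allI)
  fix i j :: 'n
  have "unit_wedge i j = mat_scale (-1) (unit_wedge j i :: 'a^'n^'n)"
    by (simp add: vec_eq_iff wedge_component)
  then have "f (unit_wedge i j) = -1 * f (unit_wedge j i)"
    using assms by (simp only: linear_form_def skew_wedge)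
  then show "dual_matrix f $ i $ j = - dual_matrix f $ j $ i"
    by (simp add: dual_matrix_component)
  have "unit_wedge i i = (0 :: 'a^'n^'n)"
    by (simp add: vec_eq_iff wedge_component)
  then show "dual_matrix f $ i $ i = 0"
    using linear_form_zero[OF assms vector_space_mat_scale skew_zero] by (simp add: dual_matrix_component)
qed

lemma matrix_dual_in_dual_space: "matrix_dual ord B \<in> dual_space mat_scale skew_matrices"
  by (simp add: dual_space_def linear_form_def matrix_dual_def skew_add skew_scale
      distrib_right sum.distrib sum_distrib_left mult.assoc)

lemma matrix_dual_dual_matrix:
  assumes f: "f \<in> dual_space mat_scale skew_matrices" and ord: "inj ord"
  shows "matrix_dual ord (dual_matrix f) = f"
proof
  fix A
  note lf = dual_spaceD[OF f]
  show "matrix_dual ord (dual_matrix f) A = f A"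
  proof (cases "A \<in> skew_matrices")
    case True
    have "f A = f (\<Sum>e | ord (fst e) < ord (snd e). mat_scale (A $ fst e $ snd e) (unit_wedge (fst e) (snd e)))"
      using skew_expand[OF True ord] by (rule arg_cong)
    also have "\<dots> = (\<Sum>e | ord (fst e) < ord (snd e). f (mat_scale (A $ fst e $ snd e) (unit_wedge (fst e) (snd e))))"
      by (rule linear_form_sum[OF lf vector_space_mat_scale subspace_skew_matrices])
        (intro skew_scale skew_wedge)
    also have "\<dots> = matrix_dual ord (dual_matrix f) A"
      using lf True by (simp add: linear_form_def skew_wedge matrix_dual_def dual_matrix_component)
    finally show ?thesis ..
  next
    case False
    then show ?thesis
      using f by (simp add: matrix_dual_def dual_space_def)
  qed
qed

lemma dual_matrix_matrix_dual:
  fixes B :: "'a::field^'n^'n"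
  assumes B: "B \<in> skew_matrices" and ord: "inj ord"
  shows "dual_matrix (matrix_dual ord B) = B"
proof -
  have sym: "unit_wedge k l $ i $ j = (unit_wedge i j $ k $ l :: 'a)" for i j k l :: 'n
    unfolding unit_wedge_component by (simp only: eq_commute conj_commute)
  have "dual_matrix (matrix_dual ord B) $ k $ l = B $ k $ l" for k l
  proof -
    have "dual_matrix (matrix_dual ord B) $ k $ l =
        (\<Sum>e | ord (fst e) < ord (snd e). mat_scale (B $ fst e $ snd e) (unit_wedge (fst e) (snd e))) $ k $ l"
      unfolding dual_matrix_component matrix_dual_def sum_component mat_scale_component sym[of k l]
      by (simp add: skew_wedge mult.commute)
    then show ?thesis
      using skew_expand[OF B ord] by simp
  qed
  then show ?thesis
    by (simp add: vec_eq_iff)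
qed

text \<open>
  For the matrix \<open>B\<close> of a functional that vanishes on the tangent space at \<open>x\<close>, the tangent lines give
  \<open>x B = 0\<close> if \<open>x\<close> has rank \<open>r\<close>, and \<open>B = 0\<close> if \<open>x\<close> has smaller rank.
\<close>

lemma conormal_rank_le:
  fixes x :: "'a::alg_closed_field^'n^'n"
  assumes r: "even r" "r \<le> even_floor CARD('n)"
    and x: "x \<in> skew_determinantal r" and f: "linear_form mat_scale skew_matrices f"
    and T: "\<And>v. v \<in> tangent_space mat_scale skew_matrices (skew_determinantal r) x \<Longrightarrow> f v = 0"
  shows "rank (dual_matrix f) \<le> even_floor CARD('n) - r"
proof -
  let ?B = "dual_matrix f"
  have sx: "x \<in> skew_matrices" "rank x \<le> r"
    using x by (auto simp: skew_determinantal_def)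
  show ?thesis
  proof (cases "rank x = r")
    case True
    have "(transpose x ** ?B) $ l $ j = 0" for l j
    proof -
      have "0 = f (wedge (x *v axis l 1) (axis j 1))"
        using T wedge_in_tangent_space[OF x] by simp
      also have "\<dots> = (\<Sum>i\<in>UNIV. \<Sum>k\<in>UNIV. (x *v axis l 1) $ i * axis j 1 $ k * f (unit_wedge i k))"
        by (rule linear_form_wedge[OF f])
      also have "\<dots> = (\<Sum>i\<in>UNIV. \<Sum>k\<in>UNIV. if k = j then x $ i $ l * f (unit_wedge i k) else 0)"
        unfolding matrix_vector_axis
        by (intro sum.cong refl) (simp add: column_def axis_def)
      also have "\<dots> = (transpose x ** ?B) $ l $ j"
        by (simp add: matrix_matrix_mult_def transpose_def dual_matrix_component)
      finally show ?thesis ..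
    qed
    then have "x ** ?B = 0"
      using skew_transpose[OF sx(1)] by (simp add: matrix_mult_uminus vec_eq_iff)
    then have le: "r + rank ?B \<le> CARD('n)"
      using rank_add_le_if_mult_0 True by blast
    have "even (r + rank ?B)"
      using r(1) even_rank_skew[OF skew_dual_matrix[OF f]] by simp
    then have "r + rank ?B \<le> even_floor CARD('n)"
      using le unfolding even_floor_def
      by (cases "r + rank ?B = CARD('n)") (auto simp del: even_add)
    then show ?thesis
      by linarith
  next
    case False
    have "even (rank x)"
      using sx(1) by (rule even_rank_skew)
    then have "rank x + 2 \<le> r"
      using False sx(2) r(1) by presburger
    have "f (unit_wedge i j) = 0" for i j
    proof (rule T, rule line_in_tangent_space[OF skew_wedge])
      fix t :: 'a
      have "mat_scale t (unit_wedge i j) = wedge (t *s axis i 1) (axis j 1)"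
        by (simp add: vec_eq_iff wedge_component algebra_simps)
      then have "rank (mat_scale t (unit_wedge i j) :: 'a^'n^'n) \<le> 2"
        using rank_wedge_le[of "t *s axis i 1" "axis j 1"] by simp
      then have "rank (x + mat_scale t (unit_wedge i j)) \<le> r"
        using rank_add_le[of x "mat_scale t (unit_wedge i j)"] \<open>rank x + 2 \<le> r\<close> by linarith
      then show "x + mat_scale t (unit_wedge i j) \<in> skew_determinantal r"
        by (simp add: skew_determinantal_def sx skew_add skew_scale skew_wedge)
    qed
    then have "rank ?B \<le> card ({} :: 'n set)"
      by (intro rank_le_card_rows) (simp add: row_def vec_eq_iff dual_matrix_component)
    then show ?thesis
      by simp
  qed
qed

text \<open>The set whose closure is the conormal variety.\<close>

definition conormal_pairs :: "nat \<Rightarrow> (('a::alg_closed_field^'n^'n) \<times> ('a^'n^'n \<Rightarrow> 'a)) set" where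
  "conormal_pairs r = {(x, f). smooth_point mat_scale skew_matrices (skew_determinantal r) x \<and>
    f \<in> dual_space mat_scale skew_matrices \<and>
    (\<forall>v\<in>tangent_space mat_scale skew_matrices (skew_determinantal r) x. f v = 0)}"

lemma (in normal_point) conormal_at_point:
  assumes f: "f \<in> dual_space mat_scale skew_matrices"
    and ker: "\<And>i l. i \<in> I \<Longrightarrow> (dual_matrix f ** P) $ l $ i = 0"
  shows "(point, f) \<in> conormal_pairs (card I)"
proof -
  note lf = dual_spaceD[OF f]
  have 0: "f (congruent_matrix P (unit_wedge i j)) = 0" if "i \<in> I" for i j
  proof -
    have "f (congruent_matrix P (unit_wedge i j)) = f (wedge (column i P) (column j P))"
      by (simp add: congruent_wedge matrix_vector_axis)
    also have "\<dots> = (\<Sum>k\<in>UNIV. \<Sum>l\<in>UNIV. P $ k $ i * P $ l $ j * dual_matrix f $ k $ l)"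
      by (subst linear_form_wedge[OF lf]) (simp add: column_def dual_matrix_component)
    also have "\<dots> = (\<Sum>l\<in>UNIV. - P $ l $ j * (\<Sum>k\<in>UNIV. dual_matrix f $ l $ k * P $ k $ i))"
      unfolding sum_distrib_left
      by (subst sum.swap, intro sum.cong refl, subst skew_swap[OF skew_dual_matrix[OF lf]])
        (simp add: algebra_simps)
    also have "\<dots> = (\<Sum>l\<in>UNIV. - P $ l $ j * (dual_matrix f ** P) $ l $ i)"
      by (simp add: matrix_matrix_mult_def)
    finally show ?thesis
      using ker[OF that] by simp
  qed
  have "f v = 0" if v: "v \<in> tangent_space mat_scale skew_matrices Z point" for v
  proof -
    obtain c where c: "v = (\<Sum>e\<in>E. mat_scale (c e) (congruent_matrix P (unit_wedge (fst e) (snd e))))"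
      using tangent_expand[OF v] .
    have "f v = (\<Sum>e\<in>E. f (mat_scale (c e) (congruent_matrix P (unit_wedge (fst e) (snd e)))))"
      unfolding c by (intro linear_form_sum[OF lf vector_space_mat_scale subspace_skew_matrices]
          skew_scale skew_congruent skew_wedge)
    also have "\<dots> = 0"
      using lf by (intro sum.neutral) (auto simp: linear_form_def skew_congruent skew_wedge 0 E_def)
    finally show ?thesis .
  qed
  then show ?thesis
    using f smooth_point_congruent by (simp add: conormal_pairs_def)
qed

text \<open>
  A functional whose matrix \<open>B\<close> has a kernel of dimension at least \<open>r\<close> is conormal at all the
  multiples \<open>u\<^sup>2 x\<close>, \<open>u \<noteq> 0\<close>, of a suitable \<open>x\<close>, which is constructed with rank \<open>r\<close> and with its image
  in this kernel.
\<close>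

lemma conormal_ray:
  fixes f :: "'a::alg_closed_field^'n^'n \<Rightarrow> 'a"
  assumes f: "f \<in> dual_space mat_scale skew_matrices" and r: "even r"
    and rank: "rank (dual_matrix f) + r \<le> CARD('n)"
  obtains x where "x \<in> skew_matrices" "\<And>u. u \<noteq> 0 \<Longrightarrow> (mat_scale (u * u) x, f) \<in> conormal_pairs r"
proof -
  obtain K and C G :: "'a^'n^'n" where B: "card K = rank (dual_matrix f)" "det G \<noteq> 0"
      "dual_matrix f = C ** G" "\<And>i j. j \<notin> K \<Longrightarrow> C $ i $ j = 0"
    using rank_factorization[of "dual_matrix f"] by metis
  have "r \<le> card (- K)"
    using rank B(1) by (simp add: Compl_eq_Diff_UNIV card_Diff_subset)
  then obtain I where I: "I \<subseteq> - K" "card I = r"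
    using obtain_subset_with_card_n by metis
  obtain P where P: "G ** P = mat 1" "P ** G = mat 1"
    using B(2) unfolding invertible_det_nz[symmetric] invertible_def by blast
  obtain J :: "'a^'n^'n" where J: "J \<in> skew_matrices" "\<And>i j. i \<notin> I \<Longrightarrow> J $ i $ j = 0"
      "J ** J = - coord_projection I"
    using symplectic_form_exists[of I] r I(2) by metis
  obtain g :: "'n \<Rightarrow> nat" where g: "inj g"
    using finite_imp_inj_to_nat_seg[of "UNIV :: 'n set"] by auto
  \<comment> \<open>the shift puts the indices outside \<open>I\<close> behind those in \<open>I\<close>\<close>
  define ord where "ord i = (if i \<in> I then g i else g i + Suc (Max (range g)))" for i
  have g_le: "g i < Suc (Max (range g))" for i
    by (rule le_imp_less_Suc, rule Max_ge) simp_all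
  have ord_less: "ord i < ord j" if "i \<in> I" "j \<notin> I" for i j
    using that g_le[of i] by (simp add: ord_def)
  have "inj ord"
  proof (rule injI)
    fix i j assume "ord i = ord j"
    then show "i = j"
      using ord_less[of i j] ord_less[of j i] injD[OF g, of i j]
      by (cases "i \<in> I"; cases "j \<in> I") (auto simp: ord_def)
  qed
  have "(mat_scale (u * u) (congruent_matrix P J), f) \<in> conormal_pairs r" if "u \<noteq> 0" for u
  proof -
    interpret normal_point "mat_scale u P" "mat_scale (inverse u) G" J I ord
    proof
      show "mat_scale (inverse u) G ** mat_scale u P = mat 1" "mat_scale u P ** mat_scale (inverse u) G = mat 1"
        using that by (simp_all add: mat_scale_mult P) (simp_all add: vec_eq_iff)
    qed (fact J \<open>inj ord\<close> ord_less)+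
    have "(dual_matrix f ** mat_scale u P) $ l $ i = 0" if "i \<in> I" for i l
    proof -
      have "dual_matrix f ** mat_scale u P = mat_scale u (C ** (G ** P))"
        unfolding B(3) mat_scale_mult by (simp add: matrix_mul_assoc)
      then show ?thesis
        using that I(1) B(4) P(1) by auto
    qed
    then have "(congruent_matrix (mat_scale u P) J, f) \<in> conormal_pairs (card I)"
      using f by (intro conormal_at_point)
    \<comment> \<open>rescaling \<open>P\<close> by \<open>u\<close> rescales the point by \<open>u\<^sup>2\<close>\<close>
    moreover have "congruent_matrix (mat_scale u P) J = mat_scale (u * u) (congruent_matrix P J)"
    proof -
      have "transpose (mat_scale u P) = mat_scale u (transpose P)"
        by (simp add: vec_eq_iff transpose_def)
      then show ?thesis
        by (simp add: congruent_matrix_def mat_scale_mult) (simp add: vec_eq_iff mult.assoc)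
    qed
    ultimately show ?thesis
      using I(2) by simp
  qed
  then show ?thesis
    by (rule that[OF skew_congruent[OF J(1)]])
qed

lemma conormal_fibre_eq:
  assumes r: "even r" "r \<le> even_floor CARD('n::finite)"
  shows "conormal_fibre mat_scale skew_matrices (skew_determinantal r :: ('a::alg_closed_field^'n^'n) set) 0 =
    {f \<in> dual_space mat_scale skew_matrices. rank (dual_matrix f) \<le> even_floor CARD('n) - r}"
    (is "?F = ?R")
proof -
  let ?s = "cotangent_scale mat_scale :: 'a \<Rightarrow> ('a^'n^'n) \<times> ('a^'n^'n \<Rightarrow> 'a) \<Rightarrow> _"
  let ?C = "cotangent_space mat_scale skew_matrices :: (('a^'n^'n) \<times> ('a^'n^'n \<Rightarrow> 'a)) set"
  let ?S = "conormal_pairs r :: (('a^'n^'n) \<times> ('a^'n^'n \<Rightarrow> 'a)) set"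
  let ?k = "even_floor CARD('n) - r"
  have F: "?F = {f. (0, f) \<in> zariski_closure ?s ?C ?S}"
    by (simp add: conormal_fibre_def conormal_variety_def conormal_pairs_def)
  have S_Z: "fst y \<in> skew_determinantal r" if "y \<in> ?S" for y
    using that by (auto simp: conormal_pairs_def smooth_point_def)
  have S_C: "?S \<subseteq> ?C"
    using S_Z by (auto simp: cotangent_space_def conormal_pairs_def skew_determinantal_def smooth_point_def)
  show ?thesis
  proof
    have "linear_form ?s ?C (\<lambda>y. dual_matrix (snd y) $ i $ j)" for i j
      by (simp add: linear_form_def dual_matrix_component cotangent_scale_def dual_scale_def)
    then have "zariski_closed ?s ?C {y\<in>?C. rank (dual_matrix (snd y)) \<le> ?k}"
      by (intro zariski_closed_rank_le polyfun.linear)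
    moreover have "?S \<subseteq> {y\<in>?C. rank (dual_matrix (snd y)) \<le> ?k}"
    proof
      fix y assume y: "y \<in> ?S"
      then have "rank (dual_matrix (snd y)) \<le> ?k"
        using S_Z[OF y] by (intro conormal_rank_le[OF r, of "fst y"]) (auto simp: conormal_pairs_def dual_spaceD)
      then show "y \<in> {y\<in>?C. rank (dual_matrix (snd y)) \<le> ?k}"
        using S_C y by auto
    qed
    ultimately have "zariski_closure ?s ?C ?S \<subseteq> {y\<in>?C. rank (dual_matrix (snd y)) \<le> ?k}"
      by (rule zariski_closure_minimal)
    then show "?F \<subseteq> ?R"
      unfolding F by (auto simp: cotangent_space_def)
  next
    have s: "vector_space ?s"
      by (intro vector_space_cotangent_scale vector_space_mat_scale)
    interpret s: vector_space ?s
      by fact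
    have C: "s.subspace ?C"
      unfolding s.subspace_def cotangent_space_def cotangent_scale_def
      using subspace_dual_space[of mat_scale skew_matrices]
      by (auto simp: skew_zero skew_add skew_scale zero_prod_def
          module.subspace_def[OF vector_space_dual_scale[folded module_iff_vector_space]])
    show "?R \<subseteq> ?F"
    proof
      fix f assume f: "f \<in> ?R"
      have "even_floor CARD('n) \<le> CARD('n)"
        by (simp add: even_floor_def)
      then have "rank (dual_matrix f) + r \<le> CARD('n)"
        using f r(2) by auto
      then obtain x where x: "x \<in> skew_matrices"
          "\<And>u. u \<noteq> 0 \<Longrightarrow> (mat_scale (u * u) x, f) \<in> ?S"
        using conormal_ray[of f r] f r(1) by blast
      have 0: "(0, f) \<in> ?C" "(x, 0) \<in> ?C"
        using f x(1) s.subspace_0[OF C] by (auto simp: cotangent_space_def skew_zero zero_prod_def)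
      have "p (0, f) = 0" if p: "p \<in> polyfun ?s ?C" and van: "\<forall>y\<in>?S. p y = 0" for p
      proof -
        obtain q where q: "\<And>t. poly q t = p ((0, f) + ?s t (x, 0))"
          using dir_deriv_unique_poly[OF s C p 0] by blast
        have pt: "(0, f) + ?s t (x, 0) = (mat_scale t x, f)" for t
          by (simp add: cotangent_scale_def dual_scale_def fun_eq_iff)
        \<comment> \<open>the composition of \<open>q\<close> with \<open>u\<^sup>2\<close> has all nonzero \<open>u\<close> as roots\<close>
        have "poly (pcompose q [:0, 0, 1:]) u = 0" if "u \<noteq> 0" for u
          using van x(2)[OF that] by (simp add: poly_pcompose q pt)
        then have "UNIV - {0} \<subseteq> {u. poly (pcompose q [:0, 0, 1:]) u = 0}"
          by auto
        then have "infinite {u. poly (pcompose q [:0, 0, 1:]) u = 0}"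
          using infinite_UNIV_alg_closed[where 'a = 'a] finite_subset by fastforce
        then have "pcompose q [:0, 0, 1:] = 0"
          using poly_roots_finite by blast
        then have "poly (pcompose q [:0, 0, 1:]) 0 = 0"
          by simp
        moreover have "mat_scale 0 x = 0"
          by (simp add: vec_eq_iff)
        ultimately show ?thesis
          by (simp add: poly_pcompose q pt)
      qed
      then show "f \<in> ?F"
        unfolding F using 0(1) by (simp add: zariski_closure_eq[OF S_C])
    qed
  qed
qed

theorem theorem1p2:
  fixes r :: nat
  assumes "even r" and "r \<le> even_floor CARD('n::finite)"
  shows "isomorphic_varieties
    dual_scale (dual_space mat_scale skew_matrices)
      (conormal_fibre mat_scale skew_matrices
        (skew_determinantal r :: ('a::alg_closed_field^'n^'n) set) 0)
    mat_scale skew_matrices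
      (skew_determinantal (even_floor CARD('n) - r) :: ('a^'n^'n) set)"
proof -
  obtain ord :: "'n \<Rightarrow> nat" where ord: "inj ord"
    using finite_imp_inj_to_nat_seg[of "UNIV :: 'n set"] by auto
  note fibre = conormal_fibre_eq[OF assms, where 'a = 'a]
  show ?thesis
    unfolding isomorphic_varieties_def fibre
  proof (intro exI conjI ballI)
    let ?D = "dual_space mat_scale skew_matrices :: ('a^'n^'n \<Rightarrow> 'a) set"
    have "(\<lambda>f. q (dual_matrix f)) \<in> polyfun dual_scale ?D"
      if "q \<in> polyfun mat_scale skew_matrices" for q :: "'a^'n^'n \<Rightarrow> 'a"
      using that
      by (rule polyfun_comp_linear)
        (simp_all add: skew_dual_matrix dual_spaceD, simp_all add: vec_eq_iff dual_matrix_component dual_scale_def)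
    then show "morphism dual_scale ?D {f \<in> ?D. rank (dual_matrix f) \<le> even_floor CARD('n) - r}
        mat_scale skew_matrices (skew_determinantal (even_floor CARD('n) - r)) dual_matrix"
      unfolding morphism_def by (auto simp: skew_determinantal_def skew_dual_matrix dual_spaceD)
    have "(\<lambda>B. q (matrix_dual ord B)) \<in> polyfun mat_scale skew_matrices"
      if "q \<in> polyfun dual_scale ?D" for q
      using that
    proof (rule polyfun_comp_linear)
      show "matrix_dual ord (A + B) = matrix_dual ord A + matrix_dual ord B" for A B :: "'a^'n^'n"
        by (simp add: fun_eq_iff matrix_dual_def distrib_left sum.distrib)
      show "matrix_dual ord (mat_scale c B) = dual_scale c (matrix_dual ord B)" for c and B :: "'a^'n^'n"
        by (simp add: fun_eq_iff matrix_dual_def dual_scale_def sum_distrib_left mult.left_commute)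
    qed (rule matrix_dual_in_dual_space)
    then show "morphism mat_scale skew_matrices (skew_determinantal (even_floor CARD('n) - r))
        dual_scale ?D {f \<in> ?D. rank (dual_matrix f) \<le> even_floor CARD('n) - r} (matrix_dual ord)"
      unfolding morphism_def
      by (auto simp: skew_determinantal_def matrix_dual_in_dual_space dual_matrix_matrix_dual[OF _ ord])
    show "matrix_dual ord (dual_matrix f) = f"
      if "f \<in> {f \<in> ?D. rank (dual_matrix f) \<le> even_floor CARD('n) - r}" for f
      using that matrix_dual_dual_matrix[OF _ ord] by blast
    show "dual_matrix (matrix_dual ord B) = B"
      if "B \<in> skew_determinantal (even_floor CARD('n) - r)" for B :: "'a^'n^'n"
      using that dual_matrix_matrix_dual[OF _ ord] by (auto simp: skew_determinantal_def)
  qed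
qed

end
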